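(* Let $\mathbb{X}=(X,g,\xi)$ be a gm-space with bounded gauge $g$, and let $n\in\mathbb{N}$, $n\ge1$. Let $(\pi^{(k)})_{k}\subset\Pi(\xi,*_n)$ be generated by the conditional gradient algorithm with line search (described in the context), and assume the iterates satisfy $\pi^{(k)}_i(X)>0$ for all $i\in[n]$ and all $k$. Then every cluster point $\pi^\ast$ (with respect to weak convergence) of $(\pi^{(k)})_k$ with $\pi^\ast_i(X)>0$ for all $i\in[n]$ is stationary, that is, $$2\sum_{i=1}^n\int_X\hat c_i^{(\pi^\ast)}\,\mathrm{d}(\eta_i-\pi^\ast_i)\ \ge\ 0\qquad\text{for all }\eta\in\Pi(\xi,*_n).$$
   Context: A gauged measure space (gm-space) is a triple $(X,g,\xi)$ where $X$ is a Polish space, $\xi$ is a Borel probability measure on $X$, and the gauge $g\in L^2(X\times X,\xi\otimes\xi)$ is symmetric. Write $[n]=\{1,\dots,n\}$. $\Pi(\xi,*_n)$ is the set of probability measures $\pi$ on $X\times[n]$ whose marginal on $X$ is $\xi$; such $\pi$ is identified with $(\pi_i)_{i=1}^n$, $\pi_i:=\pi(\cdot\times\{i\})$, a family of finite non-negative measures on $X$ with $\sum_i\pi_i=\xi$. For a symmetric matrix $G\in\mathbb{R}^{n\times n}$, $$Q_{\mathrm{GW}}(G,\pi):=\sum_{i,i'=1}^n\iint_{X^2}(g(x,x')-G_{i,i'})^2\,\mathrm{d}\pi_i(x)\,\mathrm{d}\pi_{i'}(x').$$ For $\pi\in\Pi(\xi,*_n)$ with $\pi_i(X)>0$ for all $i$,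 set $$\hat G(\pi)_{i,i'}:=\frac{1}{\pi_i(X)\pi_{i'}(X)}\iint_{X^2}g\,\mathrm{d}\pi_i\,\mathrm{d}\pi_{i'},\qquad \hat c_i^{(\pi)}(x):=\sum_{i'=1}^n\int_X\big(g(x,x')-\hat G(\pi)_{i,i'}\big)^2\,\mathrm{d}\pi_{i'}(x').$$ For functions $(c_i)_{i=1}^n$ on $X$, the Voronoi partition $(V_i)_{i=1}^n$ of $X$ is $V_i:=T^{-1}(\{i\})$ with $T(x):=\min\{i\in[n]:c_i(x)=\min_{j\in[n]}c_j(x)\}$. Conditional gradient algorithm with line search: start from some $\pi^{(0)}\in\Pi(\xi,*_n)$ with $\pi^{(0)}_i(X)>0$ for all $i$. Given $\pi^{(k)}$, let $(V_i^{(k)})_{i=1}^n$ be the Voronoi partition of $X$ with respect to $(\hat c_i^{(\pi^{(k)})})_{i=1}^n$, set $\eta^{(k)}_i:=\xi|_{V_i^{(k)}}$ (the restriction of $\xi$ to $V_i^{(k)}$), choose $$t_k\in\operatorname*{argmin}_{s\in[0,1]}Q_{\mathrm{GW}}\big(\hat G(\pi^{(k)}),\pi^{(k)}+s(\eta^{(k)}-\pi^{(k)})\big),$$ and set $\pi^{(k+1)}:=(1-t_k)\pi^{(k)}+t_k\eta^{(k)}$. *)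

theory Defs
  imports "HOL-Probability.Probability"
begin

section \<open>Gauged measure spaces\<close>

text \<open>
  The gauge is an element of \<open>L\<^sup>2(\<xi> \<otimes> \<xi>)\<close>, given here by a measurable representative; accordingly
  symmetry and boundedness are required almost everywhere only. Changing the representative changes
  the functions \<open>c_hat\<close> below, and hence the Voronoi cells, on \<open>\<xi>\<close>-null sets only.
\<close>

locale gm_space = prob_space \<xi>
  for \<xi> :: "'a::polish_space measure" +
  fixes g :: "'a \<Rightarrow> 'a \<Rightarrow> real"
  assumes sets_xi: "sets \<xi> = sets borel"
    and gauge_measurable: "case_prod g \<in> borel_measurable (\<xi> \<Otimes>\<^sub>M \<xi>)"
    and gauge_square_integrable: "integrable (\<xi> \<Otimes>\<^sub>M \<xi>) (\<lambda>(x, x'). (g x x')\<^sup>2)"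
    and gauge_symmetric: "AE (x, x') in \<xi> \<Otimes>\<^sub>M \<xi>. g x x' = g x' x"

definition bounded_gauge :: "'a measure \<Rightarrow> ('a \<Rightarrow> 'a \<Rightarrow> real) \<Rightarrow> bool" where
  "bounded_gauge \<xi> g \<longleftrightarrow> (\<exists>B. AE (x, x') in \<xi> \<Otimes>\<^sub>M \<xi>. \<bar>g x x'\<bar> \<le> B)"


section \<open>Probability measures on \<open>X \<times> [n]\<close>\<close>

abbreviation label_space :: "nat \<Rightarrow> ('a::polish_space \<times> nat) measure" where
  "label_space n \<equiv> borel \<Otimes>\<^sub>M count_space {1..n}"

definition prob_measures :: "nat \<Rightarrow> ('a::polish_space \<times> nat) measure set" where
  "prob_measures n = {\<pi>. prob_space \<pi> \<and> sets \<pi> = sets (label_space n)}"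

definition couplings :: "'a::polish_space measure \<Rightarrow> nat \<Rightarrow> ('a \<times> nat) measure set" where
  "couplings \<xi> n = {\<pi> \<in> prob_measures n. distr \<pi> borel fst = \<xi>}"

text \<open>The component \<open>\<pi>\<^sub>i = \<pi>(\<cdot> \<times> {i})\<close>; see \<open>emeasure_component\<close>.\<close>

definition component :: "('a::polish_space \<times> nat) measure \<Rightarrow> nat \<Rightarrow> 'a measure" where
  "component \<pi> i = distr (density \<pi> (indicator (UNIV \<times> {i}))) borel fst"

lemma emeasure_component:
  assumes "sets \<pi> = sets (label_space n)" "i \<in> {1..n}" "A \<in> sets borel"
  shows "emeasure (component \<pi> i) A = emeasure \<pi> (A \<times> {i})"
proof -
  have sp: "space \<pi> = UNIV \<times> {1..n}"
    using sets_eq_imp_space_eq[OF assms(1)] by (simp add: space_pair_measure)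
  have fst: "fst \<in> measurable \<pi> borel"
    by (subst measurable_cong_sets[OF assms(1) refl]) simp
  have U: "UNIV \<times> {i} \<in> sets \<pi>" and A: "A \<times> {i} \<in> sets \<pi>"
    using assms by auto
  have "emeasure (component \<pi> i) A
      = emeasure (density \<pi> (indicator (UNIV \<times> {i}))) (fst -` A \<inter> space \<pi>)"
    unfolding component_def using fst assms(3) by (subst emeasure_distr) auto
  also have "\<dots> = (\<integral>\<^sup>+z. indicator (UNIV \<times> {i}) z * indicator (fst -` A \<inter> space \<pi>) z \<partial>\<pi>)"
    using U measurable_sets[OF fst assms(3)] by (subst emeasure_density) auto
  also have "\<dots> = (\<integral>\<^sup>+z. indicator (A \<times> {i}) z \<partial>\<pi>)"
    using assms(2) by (intro nn_integral_cong) (auto simp: sp split: split_indicator)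
  also have "\<dots> = emeasure \<pi> (A \<times> {i})"
    using A by simp
  finally show ?thesis .
qed

text \<open>The convex combination \<open>\<mu> + s(\<nu> - \<mu>) = (1 - s)\<mu> + s\<nu>\<close> for \<open>s \<in> [0,1]\<close>.\<close>

definition mix_measure :: "real \<Rightarrow> 'b measure \<Rightarrow> 'b measure \<Rightarrow> 'b measure" where
  "mix_measure s \<mu> \<nu> = measure_of (space \<mu>) (sets \<mu>)
     (\<lambda>A. ennreal (1 - s) * emeasure \<mu> A + ennreal s * emeasure \<nu> A)"

lemma sets_mix_measure [simp]: "sets (mix_measure s \<mu> \<nu>) = sets \<mu>"
  by (simp add: mix_measure_def)

lemma emeasure_mix_measure:
  assumes "sets \<nu> = sets \<mu>" "A \<in> sets \<mu>"
  shows "emeasure (mix_measure s \<mu> \<nu>) A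
    = ennreal (1 - s) * emeasure \<mu> A + ennreal s * emeasure \<nu> A"
  unfolding mix_measure_def
proof (rule emeasure_measure_of_sigma[OF _ _ _ assms(2)])
  show "sigma_algebra (space \<mu>) (sets \<mu>)" ..
  show "positive (sets \<mu>) (\<lambda>A. ennreal (1 - s) * emeasure \<mu> A + ennreal s * emeasure \<nu> A)"
    by (simp add: positive_def)
  show "countably_additive (sets \<mu>)
      (\<lambda>A. ennreal (1 - s) * emeasure \<mu> A + ennreal s * emeasure \<nu> A)"
    by (rule countably_additiveI)
      (simp add: suminf_add[symmetric] suminf_emeasure assms(1))
qed


section \<open>The Gromov--Wasserstein objective\<close>

definition Q_GW ::
  "('a::polish_space \<Rightarrow> 'a \<Rightarrow> real) \<Rightarrow> nat \<Rightarrow> (nat \<Rightarrow> nat \<Rightarrow> real) \<Rightarrow> ('a \<times> nat) measure \<Rightarrow> real" where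
  "Q_GW g n G \<pi> = (\<Sum>i=1..n. \<Sum>i'=1..n.
     \<integral>(x, x'). (g x x' - G i i')\<^sup>2 \<partial>(component \<pi> i \<Otimes>\<^sub>M component \<pi> i'))"

definition G_hat ::
  "('a::polish_space \<Rightarrow> 'a \<Rightarrow> real) \<Rightarrow> ('a \<times> nat) measure \<Rightarrow> nat \<Rightarrow> nat \<Rightarrow> real" where
  "G_hat g \<pi> i i' =
     1 / (measure (component \<pi> i) UNIV * measure (component \<pi> i') UNIV) *
     (\<integral>(x, x'). g x x' \<partial>(component \<pi> i \<Otimes>\<^sub>M component \<pi> i'))"

definition c_hat ::
  "('a::polish_space \<Rightarrow> 'a \<Rightarrow> real) \<Rightarrow> nat \<Rightarrow> ('a \<times> nat) measure \<Rightarrow> nat \<Rightarrow> 'a \<Rightarrow> real" where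
  "c_hat g n \<pi> i x = (\<Sum>i'=1..n. \<integral>x'. (g x x' - G_hat g \<pi> i i')\<^sup>2 \<partial>(component \<pi> i'))"


section \<open>The conditional gradient algorithm\<close>

definition voronoi_label :: "nat \<Rightarrow> (nat \<Rightarrow> 'a \<Rightarrow> real) \<Rightarrow> 'a \<Rightarrow> nat" where
  "voronoi_label n c x = Min {i \<in> {1..n}. c i x = Min ((\<lambda>j. c j x) ` {1..n})}"

definition voronoi_cell :: "nat \<Rightarrow> (nat \<Rightarrow> 'a \<Rightarrow> real) \<Rightarrow> nat \<Rightarrow> 'a set" where
  "voronoi_cell n c i = voronoi_label n c -` {i}"

text \<open>
  One step with line search. The measure \<open>\<eta>\<close> is determined by its components; the density with
  respect to an indicator is the restriction \<open>A \<mapsto> \<xi>(A \<inter> V\<^sub>i)\<close>, as a measure on all of \<open>X\<close>.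
\<close>

definition cond_gradient_step ::
  "'a::polish_space measure \<Rightarrow> ('a \<Rightarrow> 'a \<Rightarrow> real) \<Rightarrow> nat \<Rightarrow>
     ('a \<times> nat) measure \<Rightarrow> ('a \<times> nat) measure \<Rightarrow> bool" where
  "cond_gradient_step \<xi> g n \<pi> \<pi>' \<longleftrightarrow> (\<exists>\<eta> \<in> couplings \<xi> n. \<exists>t.
     (\<forall>i\<in>{1..n}. component \<eta> i = density \<xi> (indicator (voronoi_cell n (c_hat g n \<pi>) i))) \<and>
     is_arg_min (\<lambda>s. Q_GW g n (G_hat g \<pi>) (mix_measure s \<pi> \<eta>)) (\<lambda>s. s \<in> {0..1}) t \<and>
     \<pi>' = mix_measure t \<pi> \<eta>)"

definition cond_gradient_sequence ::
  "'a::polish_space measure \<Rightarrow> ('a \<Rightarrow> 'a \<Rightarrow> real) \<Rightarrow> nat \<Rightarrow> (nat \<Rightarrow> ('a \<times> nat) measure) \<Rightarrow> bool" where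
  "cond_gradient_sequence \<xi> g n \<pi> \<longleftrightarrow>
     \<pi> 0 \<in> couplings \<xi> n \<and> (\<forall>i\<in>{1..n}. measure (component (\<pi> 0) i) UNIV > 0) \<and>
     (\<forall>k. cond_gradient_step \<xi> g n (\<pi> k) (\<pi> (Suc k)))"


section \<open>Weak convergence\<close>

definition weakly_converges ::
  "(nat \<Rightarrow> 'b::topological_space measure) \<Rightarrow> 'b measure \<Rightarrow> bool" where
  "weakly_converges M L \<longleftrightarrow>
     (\<forall>f::'b \<Rightarrow> real. continuous_on (space L) f \<longrightarrow> bounded (f ` space L) \<longrightarrow>
        (\<lambda>k. \<integral>z. f z \<partial>(M k)) \<longlonglongrightarrow> (\<integral>z. f z \<partial>L))"

text \<open>
  The weak topology on the probability measures on a Polish space is metrizable, so its cluster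
  points are the limits of subsequences.
\<close>

definition weak_cluster_point ::
  "(nat \<Rightarrow> 'b::topological_space measure) \<Rightarrow> 'b measure \<Rightarrow> bool" where
  "weak_cluster_point M L \<longleftrightarrow> (\<exists>r. strict_mono r \<and> weakly_converges (M \<circ> r) L)"

end

theory Submission
  imports Defs
begin

text \<open>
  The algorithm minimises \<open>F(\<pi>) = Q_GW(G_hat(\<pi>), \<pi>) = min_G Q_GW(G, \<pi>)\<close>. For fixed \<open>G\<close> the objective is
  the diagonal of a symmetric bilinear form in \<open>\<pi>\<close>, so along the segment from \<open>\<pi>\<close> to \<open>\<eta>\<close> it is a
  quadratic polynomial in the step size \<open>s\<close>. Its slope at 0 is \<open>2a(\<pi>, \<eta>)\<close>, the left-hand side of the
  stationarity condition, and its curvature is bounded uniformly because the gauge is bounded.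

  The Voronoi partition minimises the slope over all couplings (\<open>Q_cross_voronoi_le\<close>), and
  re-optimising \<open>G\<close> can only lower the value further. One step with line search therefore satisfies
  \<open>F(\<pi>\<^sup>k\<^sup>+\<^sup>1) \<le> F(\<pi>\<^sup>k) + 2s a(\<pi>\<^sup>k, \<eta>) + 8B\<^sup>2s\<^sup>2\<close> for every coupling \<open>\<eta>\<close> and every \<open>s \<in> [0,1]\<close>
  (\<open>cond_gradient_step_decrease\<close>). Since \<open>F\<close> is non-negative, its values converge and their
  differences vanish in the limit. If \<open>a(\<pi>\<^sup>k, \<eta>)\<close> converges to \<open>a(\<pi>\<^sup>*, \<eta>)\<close> along the subsequence, this gives
  \<open>0 \<le> 2s a(\<pi>\<^sup>*, \<eta>) + 8B\<^sup>2s\<^sup>2\<close>, and dividing by \<open>s\<close> and letting \<open>s\<close> tend to 0 proves the claim.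

  The analytic point is the continuity of \<open>a\<close>, as weak convergence says nothing about integrals of a
  gauge that is merely measurable. What helps is that all couplings share the marginal \<open>\<xi>\<close>: their
  components lie below \<open>\<xi>\<close>, hence the limits do as well, and approximations in \<open>L\<^sup>1(\<xi>)\<close> are
  uniformly good for the whole sequence. Weak convergence thus improves to convergence against all
  functions in \<open>L\<^sup>1(\<xi>)\<close> (\<open>L1_converges_component\<close>), and products of components converge against
  \<open>L\<^sup>1(\<xi> \<otimes> \<xi>)\<close> (\<open>L1_converges_pair\<close>), which contains the gauge and its square.
\<close>


section \<open>Measures below a reference measure\<close>

text \<open>
  Every component of a coupling is a sub-measure of \<open>\<xi>\<close>, and every product of components a
  sub-measure of \<open>\<xi> \<otimes> \<xi>\<close>. Integrability, almost sure statements and \<open>L\<^sup>1\<close> bounds therefore have to be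
  checked for one reference measure only. The order on measures would not serve: it also
  compares measures on different \<open>\<sigma>\<close>-algebras.
\<close>

definition submeasure :: "'b measure \<Rightarrow> 'b measure \<Rightarrow> bool" where
  "submeasure M N \<longleftrightarrow> sets M = sets N \<and> (\<forall>A\<in>sets N. emeasure M A \<le> emeasure N A)"

lemma submeasure_sets: "submeasure M N \<Longrightarrow> sets M = sets N"
  by (simp add: submeasure_def)

lemma submeasure_space: "submeasure M N \<Longrightarrow> space M = space N"
  by (rule sets_eq_imp_space_eq[OF submeasure_sets])

lemma submeasure_emeasure: "submeasure M N \<Longrightarrow> emeasure M A \<le> emeasure N A"
  by (cases "A \<in> sets N") (auto simp: submeasure_def emeasure_notin_sets)

lemma submeasure_refl: "submeasure M M"
  by (simp add: submeasure_def)

lemma submeasure_nn_integral: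
  assumes "submeasure M N"
  shows "nn_integral M f \<le> nn_integral N f"
proof (rule nn_integral_mono_measure)
  show "M \<le> N"
    using submeasure_emeasure[OF assms]
    by (simp add: le_measure_iff submeasure_sets[OF assms] submeasure_space[OF assms] le_fun_def)
qed (rule submeasure_sets[OF assms])

lemma submeasure_AE:
  assumes "submeasure M N" "AE x in N. P x"
  shows "AE x in M. P x"
proof (rule absolutely_continuous_AE[OF submeasure_sets[OF assms(1)] _ assms(2)])
  show "absolutely_continuous N M"
    unfolding absolutely_continuous_def
  proof
    fix A assume "A \<in> null_sets N"
    then show "A \<in> null_sets M"
      using submeasure_emeasure[OF assms(1), of A] submeasure_sets[OF assms(1)]
      by (intro null_setsI) (simp_all add: null_sets_def)
  qed
qed

lemma submeasure_measurable:
  assumes "submeasure M N" "f \<in> measurable N K"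
  shows "f \<in> measurable M K"
  using assms(2) measurable_cong_sets[OF submeasure_sets[OF assms(1)] refl] by blast

lemma submeasure_integrable:
  fixes f :: "'b \<Rightarrow> real"
  assumes "submeasure M N" "integrable N f"
  shows "integrable M f"
  unfolding integrable_iff_bounded
proof
  show "f \<in> borel_measurable M"
    by (rule submeasure_measurable[OF assms(1) borel_measurable_integrable[OF assms(2)]])
  show "(\<integral>\<^sup>+x. ennreal (norm (f x)) \<partial>M) < \<infinity>"
    by (rule le_less_trans[OF submeasure_nn_integral[OF assms(1)]])
      (use assms(2) in \<open>simp add: integrable_iff_bounded\<close>)
qed

lemma submeasure_abs_integral_le:
  fixes f :: "'b \<Rightarrow> real"
  assumes "submeasure M N" "integrable N f"
  shows "\<bar>\<integral>x. f x \<partial>M\<bar> \<le> (\<integral>x. \<bar>f x\<bar> \<partial>N)"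
proof -
  have "\<bar>\<integral>x. f x \<partial>M\<bar> \<le> (\<integral>x. \<bar>f x\<bar> \<partial>M)"
    by (rule integral_abs_bound)
  also have "\<dots> \<le> (\<integral>x. \<bar>f x\<bar> \<partial>N)"
  proof -
    have "ennreal (\<integral>x. \<bar>f x\<bar> \<partial>M) \<le> ennreal (\<integral>x. \<bar>f x\<bar> \<partial>N)"
      using submeasure_nn_integral[OF assms(1), of "\<lambda>x. ennreal \<bar>f x\<bar>"]
        submeasure_integrable[OF assms] assms(2)
      by (simp add: nn_integral_eq_integral)
    then show ?thesis
      by (subst (asm) ennreal_le_iff) auto
  qed
  finally show ?thesis .
qed

lemma submeasure_finite_measure:
  assumes "submeasure M N" "finite_measure N"
  shows "finite_measure M"
proof
  show "emeasure M (space M) \<noteq> \<infinity>"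
    using submeasure_emeasure[OF assms(1), of "space M"] finite_measure.emeasure_finite[OF assms(2)]
    by (auto simp: top_unique)
qed

text \<open>
  By Tonelli, an upper bound on the measures of the slices passes to the measure of the set.
\<close>

lemma submeasure_pair:
  assumes "submeasure M M'" "submeasure N N'" "finite_measure M'" "finite_measure N'"
  shows "submeasure (M \<Otimes>\<^sub>M N) (M' \<Otimes>\<^sub>M N')"
  unfolding submeasure_def
proof (intro conjI ballI)
  show sets: "sets (M \<Otimes>\<^sub>M N) = sets (M' \<Otimes>\<^sub>M N')"
    by (rule sets_pair_measure_cong[OF submeasure_sets[OF assms(1)] submeasure_sets[OF assms(2)]])
  interpret N: finite_measure N
    by (rule submeasure_finite_measure[OF assms(2,4)])
  interpret N': finite_measure N' by fact
  fix A assume A: "A \<in> sets (M' \<Otimes>\<^sub>M N')"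
  have "emeasure (M \<Otimes>\<^sub>M N) A = (\<integral>\<^sup>+x. emeasure N (Pair x -` A) \<partial>M)"
    using A sets by (simp add: N.emeasure_pair_measure_alt)
  also have "\<dots> \<le> (\<integral>\<^sup>+x. emeasure N' (Pair x -` A) \<partial>M)"
    by (intro nn_integral_mono submeasure_emeasure assms)
  also have "\<dots> \<le> (\<integral>\<^sup>+x. emeasure N' (Pair x -` A) \<partial>M')"
    by (intro submeasure_nn_integral assms)
  also have "\<dots> = emeasure (M' \<Otimes>\<^sub>M N') A"
    using A by (simp add: N'.emeasure_pair_measure_alt)
  finally show "emeasure (M \<Otimes>\<^sub>M N) A \<le> emeasure (M' \<Otimes>\<^sub>M N') A" .
qed


section \<open>Convergence against integrable functions\<close>

text \<open>
  For measures below \<open>N\<close> this is the weak-* convergence of their densities in \<open>L\<^sup>\<infinity>(N)\<close>. In contrast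
  to weak convergence it allows discontinuous integrands such as the gauge.
\<close>

definition L1_converges :: "'b measure \<Rightarrow> (nat \<Rightarrow> 'b measure) \<Rightarrow> 'b measure \<Rightarrow> bool" where
  "L1_converges N \<mu> \<nu> \<longleftrightarrow>
     (\<forall>h::'b \<Rightarrow> real. integrable N h \<longrightarrow> (\<lambda>k. \<integral>x. h x \<partial>(\<mu> k)) \<longlonglongrightarrow> (\<integral>x. h x \<partial>\<nu>))"

lemma L1_convergesD:
  fixes h :: "'b \<Rightarrow> real"
  shows "L1_converges N \<mu> \<nu> \<Longrightarrow> integrable N h \<Longrightarrow> (\<lambda>k. \<integral>x. h x \<partial>(\<mu> k)) \<longlonglongrightarrow> (\<integral>x. h x \<partial>\<nu>)"
  by (simp add: L1_converges_def)

text \<open>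
  All measures involved lie below \<open>N\<close>, so replacing \<open>h\<close> by an approximation that is close in
  \<open>L\<^sup>1(N)\<close> changes all integrals by little, uniformly in the index of the sequence. The integrands
  along which the integrals converge thus form a closed set in \<open>L\<^sup>1(N)\<close>; the approximation is
  stated as dominated convergence, the form in which it arises.
\<close>

lemma tendsto_integral_L1_closed:
  fixes h w :: "'b \<Rightarrow> real" and s :: "nat \<Rightarrow> 'b \<Rightarrow> real"
  assumes sub: "\<And>k. submeasure (\<mu> k) N" "submeasure \<nu> N"
    and [measurable]: "h \<in> borel_measurable N" "\<And>j. s j \<in> borel_measurable N"
    and w: "integrable N w"
    and lim: "AE x in N. (\<lambda>j. s j x) \<longlonglongrightarrow> h x"
    and bound: "\<And>j. AE x in N. \<bar>s j x\<bar> \<le> w x"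
    and conv: "\<And>j. (\<lambda>k. \<integral>x. s j x \<partial>(\<mu> k)) \<longlonglongrightarrow> (\<integral>x. s j x \<partial>\<nu>)"
  shows "(\<lambda>k. \<integral>x. h x \<partial>(\<mu> k)) \<longlonglongrightarrow> (\<integral>x. h x \<partial>\<nu>)"
proof (rule LIMSEQ_I)
  fix e :: real assume "e > 0"
  have int_h: "integrable N h"
    by (rule integrable_dominated_convergence[of h N s w]) (use w lim bound in simp_all)
  have int_s: "integrable N (s j)" for j
    by (rule integrable_dominated_convergence2[of h N s w]) (use w lim bound in simp_all)
  have hw: "AE x in N. \<bar>h x\<bar> \<le> w x"
  proof -
    have "AE x in N. \<forall>j. \<bar>s j x\<bar> \<le> w x"
      using bound by (simp add: AE_all_countable)
    with lim show ?thesis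
    proof eventually_elim
      case (elim x)
      show ?case
        by (rule LIMSEQ_le_const2[OF tendsto_rabs[OF elim(1)]]) (use elim(2) in auto)
    qed
  qed
  have "(\<lambda>j. \<integral>x. \<bar>h x - s j x\<bar> \<partial>N) \<longlonglongrightarrow> (\<integral>x. 0 \<partial>N)"
  proof (rule integral_dominated_convergence[where w = "\<lambda>x. 2 * w x"])
    show "AE x in N. (\<lambda>j. \<bar>h x - s j x\<bar>) \<longlonglongrightarrow> 0"
      using lim
    proof eventually_elim
      case (elim x)
      show ?case
        using tendsto_rabs[OF tendsto_diff[OF tendsto_const[of "h x"] elim]] by simp
    qed
    show "AE x in N. norm \<bar>h x - s j x\<bar> \<le> 2 * w x" for j
      using hw bound[of j] by eventually_elim auto
  qed (use w in auto)
  then have "\<forall>\<^sub>F j in sequentially. (\<integral>x. \<bar>h x - s j x\<bar> \<partial>N) < e / 3"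
    using \<open>e > 0\<close> order_tendstoD(2)[of _ 0 sequentially "e / 3"] by simp
  then obtain j where j: "(\<integral>x. \<bar>h x - s j x\<bar> \<partial>N) < e / 3"
    by (auto simp: eventually_sequentially)
  \<comment> \<open>The error of the approximation is the same for all measures below \<open>N\<close>.\<close>
  have close: "\<bar>(\<integral>x. h x \<partial>M) - (\<integral>x. s j x \<partial>M)\<bar> < e / 3" if "submeasure M N" for M
  proof -
    have "(\<integral>x. h x \<partial>M) - (\<integral>x. s j x \<partial>M) = (\<integral>x. h x - s j x \<partial>M)"
      using submeasure_integrable[OF that] int_h int_s by simp
    also have "\<bar>\<dots>\<bar> \<le> (\<integral>x. \<bar>h x - s j x\<bar> \<partial>N)"
      using int_h int_s by (intro submeasure_abs_integral_le that) auto
    finally show ?thesis using j by simp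
  qed
  obtain K where K: "\<And>k. k \<ge> K \<Longrightarrow> \<bar>(\<integral>x. s j x \<partial>(\<mu> k)) - (\<integral>x. s j x \<partial>\<nu>)\<bar> < e / 3"
    using LIMSEQ_D[OF conv[of j], of "e / 3"] \<open>e > 0\<close> by auto
  have "\<bar>(\<integral>x. h x \<partial>(\<mu> k)) - (\<integral>x. h x \<partial>\<nu>)\<bar> < e" if "k \<ge> K" for k
    using K[OF that] close[OF sub(1)[of k]] close[OF sub(2)] by linarith
  then show "\<exists>K. \<forall>k\<ge>K. norm ((\<integral>x. h x \<partial>(\<mu> k)) - (\<integral>x. h x \<partial>\<nu>)) < e"
    by auto
qed

text \<open>
  Thanks to the domination by \<open>N\<close> the sets with convergent measure form a Dynkin system: the
  tails of a disjoint union are uniformly small. From sets the convergence passes to simple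
  functions by linearity and to all of \<open>L\<^sup>1(N)\<close> by closedness.
\<close>

lemma L1_converges_from_generator:
  fixes \<mu> :: "nat \<Rightarrow> 'b measure"
  assumes fin: "finite_measure N"
    and sub: "\<And>k. submeasure (\<mu> k) N" "submeasure \<nu> N"
    and gen: "sets N = sigma_sets (space N) G" "Int_stable G" "G \<subseteq> Pow (space N)"
    and base: "\<And>A. A \<in> G \<Longrightarrow> (\<lambda>k. measure (\<mu> k) A) \<longlonglongrightarrow> measure \<nu> A"
    and total: "(\<lambda>k. measure (\<mu> k) (space N)) \<longlonglongrightarrow> measure \<nu> (space N)"
  shows "L1_converges N \<mu> \<nu>"
  unfolding L1_converges_def
proof (intro allI impI)
  interpret N: finite_measure N by fact
  note sets[simp] = submeasure_sets[OF sub(1)] submeasure_sets[OF sub(2)]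
  note space[simp] = submeasure_space[OF sub(1)] submeasure_space[OF sub(2)]
  have ind: "(\<integral>x. indicator A x \<partial>M) = measure M A" if "A \<in> sets N" "submeasure M N" for A and M :: "'b measure"
    using sets.sets_into_space[OF that(1)] by (simp add: submeasure_space[OF that(2)] Int_absorb2)
  have sets_conv: "(\<lambda>k. measure (\<mu> k) A) \<longlonglongrightarrow> measure \<nu> A" if "A \<in> sets N" for A
    using gen(2,3) that[unfolded gen(1)]
  proof (induction rule: sigma_sets_induct_disjoint)
    case (compl A)
    have "A \<in> sets N" using compl(1) gen(1) by simp
    then have "measure M (space N - A) = measure M (space N) - measure M A" if "submeasure M N" for M
      using finite_measure.finite_measure_compl[OF submeasure_finite_measure[OF that fin], of A]
      by (simp add: submeasure_space[OF that] submeasure_sets[OF that])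
    then show ?case
      using tendsto_diff[OF total compl(2)] sub by simp
  next
    case (union A)
    have A[measurable]: "A i \<in> sets N" for i using union(2) gen(1) by auto
    have U: "(\<Union>i. A i) \<in> sets N" by measurable
    have P: "(\<Union>i<j. A i) \<in> sets N" for j by measurable
    have "(\<lambda>k. \<integral>x. indicator (\<Union>i. A i) x \<partial>(\<mu> k)) \<longlonglongrightarrow> ((\<integral>x. indicator (\<Union>i. A i) x \<partial>\<nu>) :: real)"
    proof (rule tendsto_integral_L1_closed[where s = "\<lambda>j. indicator (\<Union>i<j. A i)" and w = "\<lambda>_. 1", OF sub])
      show "AE x in N. (\<lambda>j. indicator (\<Union>i<j. A i) x) \<longlonglongrightarrow> (indicator (\<Union>i. A i) x :: real)"
        by (intro AE_I2 LIMSEQ_indicator_UN)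
      show "AE x in N. \<bar>indicator (\<Union>i<j. A i) x\<bar> \<le> (1::real)" for j
        by (auto split: split_indicator)
      have "measure M (\<Union>i<j. A i) = (\<Sum>i<j. measure M (A i))" if "submeasure M N" for M j
        using finite_measure.finite_measure_finite_Union[OF submeasure_finite_measure[OF that fin], of "{..<j}" A]
          union(1) A by (auto simp: submeasure_sets[OF that] disjoint_family_on_def image_subset_iff)
      then show "(\<lambda>k. \<integral>x. indicator (\<Union>i<j. A i) x \<partial>(\<mu> k)) \<longlonglongrightarrow> ((\<integral>x. indicator (\<Union>i<j. A i) x \<partial>\<nu>) :: real)" for j
        using tendsto_sum[of "{..<j}" "\<lambda>i k. measure (\<mu> k) (A i)" "\<lambda>i. measure \<nu> (A i)" sequentially, OF union(3)]
        by (simp add: ind[OF P] sub)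
    qed (use U P in auto)
    then show ?case by (simp add: ind[OF U] sub)
  qed (use base in auto)
  fix h :: "'b \<Rightarrow> real" assume "integrable N h"
  then show "(\<lambda>k. \<integral>x. h x \<partial>(\<mu> k)) \<longlonglongrightarrow> (\<integral>x. h x \<partial>\<nu>)"
  proof (induction rule: integrable_induct)
    case (base A c)
    then show ?case
      using tendsto_mult_right[OF sets_conv[of A], of c] by (simp add: ind sub)
  next
    case (add f g)
    then have "(\<integral>x. f x + g x \<partial>M) = (\<integral>x. f x \<partial>M) + (\<integral>x. g x \<partial>M)" if "submeasure M N" for M
      using submeasure_integrable[OF that] by simp
    then show ?case
      using tendsto_add[OF add(3,4)] by (simp add: sub)
  next
    case (lim f s)
    show ?case
    proof (rule tendsto_integral_L1_closed[where s = s and w = "\<lambda>x. 2 * \<bar>f x\<bar>", OF sub])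
      show "integrable N (\<lambda>x. 2 * \<bar>f x\<bar>)" using integrable_abs[OF lim(4)] by simp
    qed (use lim in auto)
  qed
qed

text \<open>
  On rectangles the product measures are products of convergent real sequences, and
  rectangles generate the product \<open>\<sigma>\<close>-algebra.
\<close>

lemma L1_converges_pair:
  assumes fin: "finite_measure N" "finite_measure N'"
    and sub: "\<And>k. submeasure (\<mu> k) N" "submeasure \<mu>' N"
    and sub': "\<And>k. submeasure (\<nu> k) N'" "submeasure \<nu>' N'"
    and conv: "L1_converges N \<mu> \<mu>'" "L1_converges N' \<nu> \<nu>'"
  shows "L1_converges (N \<Otimes>\<^sub>M N') (\<lambda>k. \<mu> k \<Otimes>\<^sub>M \<nu> k) (\<mu>' \<Otimes>\<^sub>M \<nu>')"
proof (rule L1_converges_from_generator[where G = "{a \<times> b | a b. a \<in> sets N \<and> b \<in> sets N'}"])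
  show "finite_measure (N \<Otimes>\<^sub>M N')"
    by (intro finite_measure_pair_measure fin)
  show "sets (N \<Otimes>\<^sub>M N') = sigma_sets (space (N \<Otimes>\<^sub>M N')) {a \<times> b |a b. a \<in> sets N \<and> b \<in> sets N'}"
    by (simp add: sets_pair_measure space_pair_measure)
  have rect: "(\<lambda>k. measure (\<mu> k \<Otimes>\<^sub>M \<nu> k) (a \<times> b)) \<longlonglongrightarrow> measure (\<mu>' \<Otimes>\<^sub>M \<nu>') (a \<times> b)"
    if ab: "a \<in> sets N" "b \<in> sets N'" for a b
  proof -
    have M: "measure (M1 \<Otimes>\<^sub>M M2) (a \<times> b) = measure M1 a * measure M2 b"
      if "submeasure M1 N" "submeasure M2 N'" for M1 M2
    proof -
      interpret finite_measure M2 using that fin submeasure_finite_measure by blast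
      show ?thesis
        using ab by (simp add: measure_def emeasure_pair_measure_Times submeasure_sets[OF that(1)]
            submeasure_sets[OF that(2)] enn2real_mult)
    qed
    have I: "(\<lambda>k. measure (\<mu> k) a) \<longlonglongrightarrow> measure \<mu>' a" "(\<lambda>k. measure (\<nu> k) b) \<longlonglongrightarrow> measure \<nu>' b"
      using L1_convergesD[OF conv(1), of "indicator a"] L1_convergesD[OF conv(2), of "indicator b"] ab
        sets.sets_into_space[OF ab(1)] sets.sets_into_space[OF ab(2)]
      by (simp_all add: submeasure_space[OF sub(1)] submeasure_space[OF sub(2)] Int_absorb2
          submeasure_space[OF sub'(1)] submeasure_space[OF sub'(2)]
          finite_measure.emeasure_finite fin less_top[symmetric])
    show ?thesis using tendsto_mult[OF I] by (simp add: M sub sub')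
  qed
  then show "\<And>A. A \<in> {a \<times> b |a b. a \<in> sets N \<and> b \<in> sets N'} \<Longrightarrow>
      (\<lambda>k. measure (\<mu> k \<Otimes>\<^sub>M \<nu> k) A) \<longlonglongrightarrow> measure (\<mu>' \<Otimes>\<^sub>M \<nu>') A"
    by auto
  show "(\<lambda>k. measure (\<mu> k \<Otimes>\<^sub>M \<nu> k) (space (N \<Otimes>\<^sub>M N')))
      \<longlonglongrightarrow> measure (\<mu>' \<Otimes>\<^sub>M \<nu>') (space (N \<Otimes>\<^sub>M N'))"
    using rect[of "space N" "space N'"] by (simp add: space_pair_measure)
  show "submeasure (\<mu> k \<Otimes>\<^sub>M \<nu> k) (N \<Otimes>\<^sub>M N')" "submeasure (\<mu>' \<Otimes>\<^sub>M \<nu>') (N \<Otimes>\<^sub>M N')" for k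
    by (intro submeasure_pair sub sub' fin)+
  show "Int_stable {a \<times> b |a b. a \<in> sets N \<and> b \<in> sets N'}"
    by (rule Int_stable_pair_measure_generator)
  show "{a \<times> b |a b. a \<in> sets N \<and> b \<in> sets N'} \<subseteq> Pow (space (N \<Otimes>\<^sub>M N'))"
    using pair_measure_closed by (simp add: space_pair_measure)
qed


section \<open>Components of couplings\<close>

lemma sets_component [simp]: "sets (component \<pi> i) = sets borel"
  by (simp add: component_def)

lemma space_component [simp]: "space (component \<pi> i) = UNIV"
  by (simp add: component_def)

lemma measurable_fst_label:
  assumes "sets \<pi> = sets (label_space n)"
  shows "fst \<in> measurable \<pi> borel"
  by (subst measurable_cong_sets[OF assms refl]) simp

lemma space_label:
  assumes "sets \<pi> = sets (label_space n)"
  shows "space \<pi> = UNIV \<times> {1..n}"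
  using sets_eq_imp_space_eq[OF assms] by (simp add: space_pair_measure)

lemma prob_measuresD:
  assumes "\<pi> \<in> prob_measures n"
  shows "prob_space \<pi>" "sets \<pi> = sets (label_space n)"
  using assms by (auto simp: prob_measures_def)

lemma couplingsD:
  assumes "\<pi> \<in> couplings \<xi> n"
  shows "prob_space \<pi>" "sets \<pi> = sets (label_space n)" "distr \<pi> borel fst = \<xi>"
  using assms by (auto simp: couplings_def prob_measures_def)

lemma finite_measure_component:
  assumes "finite_measure \<pi>" "sets \<pi> = sets (label_space n)" "i \<in> {1..n}"
  shows "finite_measure (component \<pi> i)"
proof
  show "emeasure (component \<pi> i) (space (component \<pi> i)) \<noteq> \<infinity>"
    using finite_measure.emeasure_finite[OF assms(1)] by (simp add: emeasure_component[OF assms(2,3)])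
qed

lemma integral_component:
  fixes f :: "'a::polish_space \<Rightarrow> real"
  assumes "sets \<pi> = sets (label_space n)" "i \<in> {1..n}" and [measurable]: "f \<in> borel_measurable borel"
  shows "(\<integral>x. f x \<partial>(component \<pi> i)) = (\<integral>z. indicator (UNIV \<times> {i}) z * f (fst z) \<partial>\<pi>)"
proof -
  have [measurable]: "fst \<in> measurable \<pi> borel"
    by (rule measurable_fst_label[OF assms(1)])
  have [measurable]: "UNIV \<times> {i} \<in> sets \<pi>"
    using assms(1,2) by auto
  have "component \<pi> i = distr (density \<pi> (\<lambda>z. ennreal (indicator (UNIV \<times> {i}) z))) borel fst"
    by (simp add: component_def ennreal_indicator)
  then show ?thesis
    by (simp add: integral_distr integral_density)
qed

text \<open>
  The components partition the mass of the coupling according to the label, so their sum is its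
  marginal \<open>\<xi>\<close>.
\<close>

lemma sum_integral_component:
  fixes h :: "'a::polish_space \<Rightarrow> real"
  assumes \<pi>: "\<pi> \<in> couplings \<xi> n" and h: "integrable \<xi> h"
  shows "(\<Sum>i=1..n. \<integral>x. h x \<partial>(component \<pi> i)) = (\<integral>x. h x \<partial>\<xi>)"
proof -
  note D = couplingsD[OF \<pi>]
  have [measurable]: "fst \<in> measurable \<pi> borel"
    by (rule measurable_fst_label[OF D(2)])
  have [measurable]: "h \<in> borel_measurable borel"
    using borel_measurable_integrable[OF h] by (simp flip: D(3))
  have int: "integrable \<pi> (\<lambda>z. h (fst z))"
    using h by (simp flip: D(3) add: integrable_distr_eq)
  have S: "UNIV \<times> {i} \<in> sets \<pi>" if "i \<in> {1..n}" for i
    using that D(2) by auto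
  have "(\<Sum>i=1..n. \<integral>x. h x \<partial>(component \<pi> i))
      = (\<Sum>i=1..n. \<integral>z. indicator (UNIV \<times> {i}) z * h (fst z) \<partial>\<pi>)"
    by (intro sum.cong refl integral_component[OF D(2)]) auto
  also have "\<dots> = (\<integral>z. (\<Sum>i=1..n. indicator (UNIV \<times> {i}) z * h (fst z)) \<partial>\<pi>)"
    using integrable_mult_indicator[OF S int] by (intro Bochner_Integration.integral_sum[symmetric]) simp
  also have "\<dots> = (\<integral>z. h (fst z) \<partial>\<pi>)"
  proof (rule Bochner_Integration.integral_cong)
    fix z assume "z \<in> space \<pi>"
    then have z: "snd z \<in> {1..n}" by (auto simp: space_label[OF D(2)])
    have "(\<Sum>i=1..n. indicator (UNIV \<times> {i}) z * h (fst z)) = (\<Sum>i=1..n. if snd z = i then h (fst z) else 0)"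
      by (intro sum.cong refl) (auto split: split_indicator simp: mem_Times_iff)
    then show "(\<Sum>i=1..n. indicator (UNIV \<times> {i}) z * h (fst z)) = h (fst z)"
      using z by simp
  qed simp
  also have "\<dots> = (\<integral>x. h x \<partial>\<xi>)"
    by (simp flip: D(3) add: integral_distr)
  finally show ?thesis .
qed

lemma submeasure_component:
  assumes \<pi>: "\<pi> \<in> couplings \<xi> n" and i: "i \<in> {1..n}"
  shows "submeasure (component \<pi> i) \<xi>"
  unfolding submeasure_def
proof (intro conjI ballI)
  note D = couplingsD[OF \<pi>]
  show "sets (component \<pi> i) = sets \<xi>"
    by (simp flip: D(3))
  fix A assume "A \<in> sets \<xi>"
  then have A: "A \<in> sets borel" by (simp flip: D(3))
  have "emeasure (component \<pi> i) A = emeasure \<pi> (A \<times> {i})"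
    by (rule emeasure_component[OF D(2) i A])
  also have "\<dots> \<le> emeasure \<pi> (fst -` A \<inter> space \<pi>)"
    using i measurable_sets[OF measurable_fst_label[OF D(2)] A]
    by (intro emeasure_mono) (auto simp: space_label[OF D(2)])
  also have "\<dots> = emeasure \<xi> A"
    using emeasure_distr[OF measurable_fst_label[OF D(2)] A] by (simp add: D(3))
  finally show "emeasure (component \<pi> i) A \<le> emeasure \<xi> A" .
qed


section \<open>Weak limits of couplings\<close>

text \<open>
  The functions \<open>min 1 (m \<cdot> dist(x, X - U))\<close> do this; for \<open>U = X\<close> the distance is to the empty
  set, where \<open>infdist\<close> has the default value 0, so this case is separate.
\<close>

lemma open_indicator_limit_of_continuous:
  fixes U :: "'a::metric_space set"
  assumes "open U"
  obtains f :: "nat \<Rightarrow> 'a \<Rightarrow> real"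
  where "\<And>m. continuous_on UNIV (f m)" "\<And>m x. 0 \<le> f m x" "\<And>m x. f m x \<le> indicator U x"
    "\<And>x. (\<lambda>m. f m x) \<longlonglongrightarrow> indicator U x"
proof (cases "U = UNIV")
  case True
  show ?thesis
    by (rule that[of "\<lambda>_ _. 1"]) (auto simp: True)
next
  case False
  define f where "f m x = min 1 (real m * infdist x (- U))" for m x
  have zero: "infdist x (- U) = 0 \<longleftrightarrow> x \<notin> U" for x
    using in_closed_iff_infdist_zero[of "- U" x] assms False by auto
  show ?thesis
  proof (rule that[of f])
    show "continuous_on UNIV (f m)" for m
      unfolding f_def by (intro continuous_intros)
    show "0 \<le> f m x" for m x
      by (simp add: f_def infdist_nonneg)
    show "f m x \<le> indicator U x" for m x
      using zero[of x] by (auto simp: f_def split: split_indicator)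
    show "(\<lambda>m. f m x) \<longlonglongrightarrow> indicator U x" for x
    proof (cases "x \<in> U")
      case True
      then have pos: "infdist x (- U) > 0"
        using zero[of x] infdist_nonneg[of x "- U"] by linarith
      obtain M :: nat where M: "1 / infdist x (- U) \<le> real M"
        using real_arch_simple by blast
      have "f m x = 1" if "m \<ge> M" for m
      proof -
        have "1 / infdist x (- U) \<le> real m" using M that by linarith
        then show ?thesis using pos by (simp add: f_def field_simps)
      qed
      then have "\<forall>\<^sub>F m in sequentially. f m x = 1"
        by (auto simp: eventually_sequentially)
      then show ?thesis
        using True by (simp add: tendsto_eventually)
    next
      case False
      then show ?thesis using zero[of x] by (simp add: f_def)
    qed
  qed
qed

text \<open>
  The label is discrete, so a test function on \<open>X\<close> remains continuous on \<open>X \<times> [n]\<close> when it is cut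
  off outside \<open>X \<times> {i}\<close>.
\<close>

lemma weakly_converges_component:
  fixes f :: "'a::polish_space \<Rightarrow> real"
  assumes w: "weakly_converges P Q"
    and sets: "\<And>k. sets (P k) = sets (label_space n)" "sets Q = sets (label_space n)"
    and i: "i \<in> {1..n}"
    and f: "continuous_on UNIV f" "\<And>x. \<bar>f x\<bar> \<le> b"
  shows "(\<lambda>k. \<integral>x. f x \<partial>(component (P k) i)) \<longlonglongrightarrow> (\<integral>x. f x \<partial>(component Q i))"
proof -
  define h where "h z = indicator (UNIV \<times> {i}) z * f (fst z)" for z :: "'a \<times> nat"
  have h: "h = (\<lambda>z. (indicator {i} (snd z)) * f (fst z))"
    by (auto simp: h_def fun_eq_iff split: split_indicator)
  have "continuous_on S (\<lambda>z. indicator {i} (snd z) :: real)" for S :: "('a \<times> nat) set"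
    by (rule continuous_on_compose2[of UNIV "indicator {i} :: nat \<Rightarrow> real" S snd])
      (auto intro: continuous_on_snd)
  moreover have "continuous_on S (\<lambda>z. f (fst z))" for S :: "('a \<times> nat) set"
    by (rule continuous_on_compose2[OF f(1)]) (auto intro: continuous_on_fst)
  ultimately have "continuous_on (space Q) h"
    unfolding h by (intro continuous_on_mult)
  moreover have "bounded (h ` space Q)"
    unfolding bounded_iff
  proof (intro exI[of _ b] ballI)
    fix y assume "y \<in> h ` space Q"
    then obtain z where "y = h z" by blast
    then show "norm y \<le> b"
      using f(2)[of "fst z"] abs_ge_zero[of "f (fst z)"] by (auto simp: h_def split: split_indicator)
  qed
  ultimately have "(\<lambda>k. \<integral>z. h z \<partial>(P k)) \<longlonglongrightarrow> (\<integral>z. h z \<partial>Q)"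
    using w by (auto simp: weakly_converges_def)
  moreover have "f \<in> borel_measurable borel"
    by (rule borel_measurable_continuous_onI[OF f(1)])
  ultimately show ?thesis
    by (simp add: integral_component[OF sets(1) i] integral_component[OF sets(2) i] h_def)
qed

text \<open>
  For an open set the bound holds along its continuous approximations from below; outer
  regularity of \<open>\<xi>\<close> extends it to Borel sets.
\<close>

lemma submeasure_weak_limit:
  fixes \<xi> :: "'a::polish_space measure"
  assumes \<xi>: "finite_measure \<xi>" "sets \<xi> = sets borel"
    and P: "\<And>k. P k \<in> couplings \<xi> n" and Q: "Q \<in> prob_measures n"
    and w: "weakly_converges P Q" and i: "i \<in> {1..n}"
  shows "submeasure (component Q i) \<xi>"
proof -
  interpret xi: finite_measure \<xi> by fact
  note sets = couplingsD(2)[OF P] prob_measuresD(2)[OF Q]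
  interpret C: finite_measure "component Q i"
    using prob_space.axioms(1)[OF prob_measuresD(1)[OF Q]] sets(2) i by (rule finite_measure_component)
  have space_xi[simp]: "space \<xi> = UNIV"
    using sets_eq_imp_space_eq[OF \<xi>(2)] by simp
  have open_le: "measure (component Q i) U \<le> measure \<xi> U" if U: "open U" for U
  proof -
    have UB: "U \<in> sets borel" using U by simp
    obtain f :: "nat \<Rightarrow> 'a \<Rightarrow> real" where f: "\<And>m. continuous_on UNIV (f m)" "\<And>m x. 0 \<le> f m x"
      "\<And>m x. f m x \<le> indicator U x" "\<And>x. (\<lambda>m. f m x) \<longlonglongrightarrow> indicator U x"
      by (rule open_indicator_limit_of_continuous[OF U]) blast
    have f1: "\<bar>f m x\<bar> \<le> 1" for m x
      using f(2,3)[of m x] by (auto split: split_indicator_asm)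
    have fB: "f m \<in> borel_measurable borel" for m
      by (rule borel_measurable_continuous_onI[OF f(1)])
    have f_int: "integrable \<xi> (f m)" for m
      using f1 fB \<xi>(2) by (intro xi.integrable_const_bound[where B = 1]) (auto cong: measurable_cong_sets)
    have "(\<integral>x. f m x \<partial>(component Q i)) \<le> measure \<xi> U" for m
    proof (rule LIMSEQ_le_const2[OF weakly_converges_component[OF w sets i f(1) f1]], intro exI allI impI)
      fix k
      have "(\<integral>x. f m x \<partial>(component (P k) i)) \<le> (\<integral>x. \<bar>f m x\<bar> \<partial>\<xi>)"
        using submeasure_abs_integral_le[OF submeasure_component[OF P i] f_int] by (rule order_trans[OF abs_ge_self])
      also have "\<dots> \<le> (\<integral>x. indicator U x \<partial>\<xi>)"
        using f_int f(2,3) \<xi>(2) UB by (intro integral_mono) (auto simp: less_top[symmetric])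
      finally show "(\<integral>x. f m x \<partial>(component (P k) i)) \<le> measure \<xi> U" by simp
    qed
    moreover have "(\<lambda>m. \<integral>x. f m x \<partial>(component Q i)) \<longlonglongrightarrow> (\<integral>x. indicator U x \<partial>(component Q i))"
      using f1 f(4) fB UB
      by (intro integral_dominated_convergence[where w = "\<lambda>_. 1"]) (auto cong: measurable_cong_sets)
    ultimately show ?thesis
      by (intro LIMSEQ_le_const2) auto
  qed
  show ?thesis
    unfolding submeasure_def
  proof (intro conjI ballI)
    show "sets (component Q i) = sets \<xi>" by (simp add: \<xi>(2))
    fix A assume "A \<in> sets \<xi>"
    then have A: "A \<in> sets borel" by (simp add: \<xi>(2))
    have "emeasure (component Q i) A \<le> (INF U \<in> {U. A \<subseteq> U \<and> open U}. emeasure \<xi> U)"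
    proof (rule INF_greatest)
      fix U assume "U \<in> {U. A \<subseteq> U \<and> open U}"
      then have U: "A \<subseteq> U" "open U" by auto
      then have "emeasure (component Q i) A \<le> emeasure (component Q i) U"
        by (intro emeasure_mono) auto
      also have "\<dots> \<le> emeasure \<xi> U"
        using open_le[OF U(2)] by (simp add: C.emeasure_eq_measure xi.emeasure_eq_measure)
      finally show "emeasure (component Q i) A \<le> emeasure \<xi> U" .
    qed
    also have "\<dots> = emeasure \<xi> A"
      using outer_regular[OF \<xi>(2) _ A] by simp
    finally show "emeasure (component Q i) A \<le> emeasure \<xi> A" .
  qed
qed

text \<open>
  For couplings with a common marginal, weak convergence improves itself: open sets generate the
  Borel sets, and their indicators are \<open>L\<^sup>1(\<xi>)\<close>-limits of continuous functions.
\<close>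

lemma L1_converges_component:
  fixes \<xi> :: "'a::polish_space measure"
  assumes \<xi>: "finite_measure \<xi>" "sets \<xi> = sets borel"
    and P: "\<And>k. P k \<in> couplings \<xi> n" and Q: "Q \<in> prob_measures n"
    and w: "weakly_converges P Q" and i: "i \<in> {1..n}"
  shows "L1_converges \<xi> (\<lambda>k. component (P k) i) (component Q i)"
proof (rule L1_converges_from_generator[OF \<xi>(1), where G = "{U. open U}"])
  interpret xi: finite_measure \<xi> by fact
  note sets = couplingsD(2)[OF P] prob_measuresD(2)[OF Q]
  have space_xi[simp]: "space \<xi> = UNIV"
    using sets_eq_imp_space_eq[OF \<xi>(2)] by simp
  show sub: "submeasure (component (P k) i) \<xi>" "submeasure (component Q i) \<xi>" for k
    by (rule submeasure_component[OF P i]) (rule submeasure_weak_limit[OF assms])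
  show "sets \<xi> = sigma_sets (space \<xi>) {U. open U}"
    using \<xi>(2) by (simp add: borel_def)
  show "Int_stable {U :: 'a set. open U}"
    by (auto simp: Int_stable_def)
  have open_conv: "(\<lambda>k. measure (component (P k) i) U) \<longlonglongrightarrow> measure (component Q i) U"
    if U: "open U" for U
  proof -
    obtain f :: "nat \<Rightarrow> 'a \<Rightarrow> real" where f: "\<And>m. continuous_on UNIV (f m)" "\<And>m x. 0 \<le> f m x"
      "\<And>m x. f m x \<le> indicator U x" "\<And>x. (\<lambda>m. f m x) \<longlonglongrightarrow> indicator U x"
      by (rule open_indicator_limit_of_continuous[OF U]) blast
    have f1: "\<bar>f m x\<bar> \<le> 1" for m x
      using f(2,3)[of m x] by (auto split: split_indicator_asm)
    have fB: "f m \<in> borel_measurable \<xi>" for m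
      using borel_measurable_continuous_onI[OF f(1)] \<xi>(2) by (simp cong: measurable_cong_sets)
    have "(\<lambda>k. \<integral>x. indicator U x \<partial>(component (P k) i)) \<longlonglongrightarrow> ((\<integral>x. indicator U x \<partial>(component Q i)) :: real)"
      by (rule tendsto_integral_L1_closed[where s = f and w = "\<lambda>_. 1", OF sub])
        (use f1 f(4) fB U \<xi>(2) borel_measurable_indicator[of U \<xi>] weakly_converges_component[OF w sets i f(1) f1] in auto)
    then show ?thesis by simp
  qed
  then show "\<And>A. A \<in> {U. open U} \<Longrightarrow> (\<lambda>k. measure (component (P k) i) A) \<longlonglongrightarrow> measure (component Q i) A"
    by simp
  show "(\<lambda>k. measure (component (P k) i) (space \<xi>)) \<longlonglongrightarrow> measure (component Q i) (space \<xi>)"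
    using open_conv[of UNIV] by simp
  show "{U. open U} \<subseteq> Pow (space \<xi>)"
    by simp
qed


section \<open>Mixtures of measures\<close>

lemma space_mix_measure [simp]: "space (mix_measure s \<mu> \<nu>) = space \<mu>"
  by (rule sets_eq_imp_space_eq) simp

lemma nn_integral_mix_measure:
  assumes "sets \<nu> = sets \<mu>" "f \<in> borel_measurable \<mu>"
  shows "(\<integral>\<^sup>+x. f x \<partial>(mix_measure s \<mu> \<nu>))
    = ennreal (1 - s) * (\<integral>\<^sup>+x. f x \<partial>\<mu>) + ennreal s * (\<integral>\<^sup>+x. f x \<partial>\<nu>)"
  using assms(2)
proof (induction rule: borel_measurable_induct)
  note space_eq = sets_eq_imp_space_eq[OF assms(1)]
  note meas[simp] = measurable_cong_sets[OF assms(1) refl] measurable_cong_sets[OF sets_mix_measure[of s \<mu> \<nu>] refl]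
  {
    case (cong f g)
    have "(\<integral>\<^sup>+x. f x \<partial>M) = (\<integral>\<^sup>+x. g x \<partial>M)" if "space M = space \<mu>" for M
      using cong(3) that by (intro nn_integral_cong) simp
    then show ?case using cong(4) by (simp add: space_eq)
  next
    case (set A)
    then show ?case by (simp add: assms(1) emeasure_mix_measure)
  next
    case (mult u c)
    then show ?case by (simp add: nn_integral_cmult distrib_left mult.left_commute)
  next
    case (add u v)
    then show ?case by (simp add: nn_integral_add distrib_left add_ac)
  next
    case (seq U)
    have S: "(\<integral>\<^sup>+x. (SUP i. U i) x \<partial>M) = (SUP i. \<integral>\<^sup>+x. U i x \<partial>M)" if "sets M = sets \<mu>" for M
    proof -
      have "U i \<in> borel_measurable M" for i
        using seq(1)[of i] measurable_cong_sets[OF that refl] by blast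
      from nn_integral_monotone_convergence_SUP[OF \<open>incseq U\<close> this] show ?thesis
        by (simp add: image_comp)
    qed
    have inc: "incseq (\<lambda>i. \<integral>\<^sup>+x. U i x \<partial>M)" for M
      using \<open>incseq U\<close> by (auto simp: incseq_def le_fun_def intro!: nn_integral_mono)
    have inc': "incseq (\<lambda>i. c * (\<integral>\<^sup>+x. U i x \<partial>M))" for M and c :: ennreal
      using inc[of M] by (auto simp: incseq_def intro!: mult_left_mono)
    show ?case
      unfolding S[OF assms(1)] S[OF refl] S[OF sets_mix_measure] seq.IH
      by (simp add: SUP_mult_left_ennreal ennreal_SUP_add[OF inc' inc'])
  }
qed

text \<open>
  A real integral is a difference of two non-negative ones, both finite here.
\<close>

lemma
  fixes f :: "'b \<Rightarrow> real"
  assumes sets: "sets \<nu> = sets \<mu>" and f: "integrable \<mu> f" "integrable \<nu> f" and s: "0 \<le> s" "s \<le> 1"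
  shows integrable_mix_measure: "integrable (mix_measure s \<mu> \<nu>) f"
    and integral_mix_measure: "(\<integral>x. f x \<partial>(mix_measure s \<mu> \<nu>))
      = (1 - s) * (\<integral>x. f x \<partial>\<mu>) + s * (\<integral>x. f x \<partial>\<nu>)"
proof -
  have [measurable]: "f \<in> borel_measurable \<mu>"
    using f by simp
  note nn = nn_integral_mix_measure[OF sets, of _ s]
  have fin: "(\<integral>\<^sup>+x. ennreal (f x) \<partial>M) < \<infinity>" "(\<integral>\<^sup>+x. ennreal (- f x) \<partial>M) < \<infinity>" if "integrable M f" for M
    using that unfolding real_integrable_def by (auto simp: less_top)
  show int: "integrable (mix_measure s \<mu> \<nu>) f"
    unfolding real_integrable_def
  proof (intro conjI)
    show "f \<in> borel_measurable (mix_measure s \<mu> \<nu>)"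
      by (simp add: measurable_cong_sets[OF sets_mix_measure refl])
    show "(\<integral>\<^sup>+x. ennreal (f x) \<partial>(mix_measure s \<mu> \<nu>)) \<noteq> \<infinity>"
      using fin[OF f(1)] fin[OF f(2)] by (auto simp add: nn ennreal_mult_eq_top_iff)
    show "(\<integral>\<^sup>+x. ennreal (- f x) \<partial>(mix_measure s \<mu> \<nu>)) \<noteq> \<infinity>"
      using fin[OF f(1)] fin[OF f(2)] by (auto simp add: nn ennreal_mult_eq_top_iff)
  qed
  have E: "enn2real (ennreal (1 - s) * a + ennreal s * b) = (1 - s) * enn2real a + s * enn2real b"
    if "a < \<infinity>" "b < \<infinity>" for a b
    using that s by (subst enn2real_plus) (auto simp: ennreal_mult_less_top enn2real_mult)
  show "(\<integral>x. f x \<partial>(mix_measure s \<mu> \<nu>)) = (1 - s) * (\<integral>x. f x \<partial>\<mu>) + s * (\<integral>x. f x \<partial>\<nu>)"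
    using fin[OF f(1)] fin[OF f(2)]
    by (simp add: real_lebesgue_integral_def[OF int] real_lebesgue_integral_def[OF f(1)]
        real_lebesgue_integral_def[OF f(2)] nn E) (simp add: algebra_simps)
qed

lemma mix_weights: "0 \<le> s \<Longrightarrow> s \<le> 1 \<Longrightarrow> ennreal (1 - s) * a + ennreal s * a = a"
  by (simp flip: distrib_right ennreal_plus)

lemma submeasure_mix_measure:
  assumes "submeasure \<mu> N" "submeasure \<nu> N" "0 \<le> s" "s \<le> 1"
  shows "submeasure (mix_measure s \<mu> \<nu>) N"
  unfolding submeasure_def
proof (intro conjI ballI)
  have sets: "sets \<nu> = sets \<mu>" "sets \<mu> = sets N"
    using submeasure_sets[OF assms(1)] submeasure_sets[OF assms(2)] by simp_all
  then show "sets (mix_measure s \<mu> \<nu>) = sets N" by simp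
  fix A assume "A \<in> sets N"
  then have "emeasure (mix_measure s \<mu> \<nu>) A = ennreal (1 - s) * emeasure \<mu> A + ennreal s * emeasure \<nu> A"
    using sets by (intro emeasure_mix_measure) auto
  also have "\<dots> \<le> ennreal (1 - s) * emeasure N A + ennreal s * emeasure N A"
    by (intro add_mono mult_left_mono submeasure_emeasure assms) auto
  finally show "emeasure (mix_measure s \<mu> \<nu>) A \<le> emeasure N A"
    using assms(3,4) by (simp add: mix_weights)
qed

lemma component_mix_measure:
  assumes sets: "sets \<pi> = sets (label_space n)" "sets \<eta> = sets (label_space n)" and i: "i \<in> {1..n}"
  shows "component (mix_measure s \<pi> \<eta>) i = mix_measure s (component \<pi> i) (component \<eta> i)"
proof (rule measure_eqI)
  fix A assume "A \<in> sets (component (mix_measure s \<pi> \<eta>) i)"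
  then have A: "A \<in> sets borel" by simp
  have m: "A \<times> {i} \<in> sets \<pi>" using A i sets by auto
  show "emeasure (component (mix_measure s \<pi> \<eta>) i) A
      = emeasure (mix_measure s (component \<pi> i) (component \<eta> i)) A"
    using A m sets by (simp add: emeasure_component[OF _ i A] emeasure_mix_measure)
qed simp

lemma mix_measure_coupling:
  assumes "\<pi> \<in> couplings \<xi> n" "\<eta> \<in> couplings \<xi> n" "0 \<le> s" "s \<le> 1"
  shows "mix_measure s \<pi> \<eta> \<in> couplings \<xi> n"
proof -
  note P = couplingsD[OF assms(1)] and E = couplingsD[OF assms(2)]
  have sets: "sets \<eta> = sets \<pi>" using P(2) E(2) by simp
  have "prob_space (mix_measure s \<pi> \<eta>)"
  proof
    show "emeasure (mix_measure s \<pi> \<eta>) (space (mix_measure s \<pi> \<eta>)) = 1"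
      using assms(3,4) prob_space.emeasure_space_1[OF P(1)] prob_space.emeasure_space_1[OF E(1)]
        sets_eq_imp_space_eq[OF sets]
      by (simp add: emeasure_mix_measure[OF sets] flip: ennreal_plus)
  qed
  moreover have "distr (mix_measure s \<pi> \<eta>) borel fst = \<xi>"
  proof (rule measure_eqI)
    show "sets (distr (mix_measure s \<pi> \<eta>) borel fst) = sets \<xi>"
      by (simp flip: P(3))
    fix A assume "A \<in> sets (distr (mix_measure s \<pi> \<eta>) borel fst)"
    then have A: "A \<in> sets borel" by simp
    have pre: "fst -` A \<inter> space \<pi> \<in> sets \<pi>"
      by (rule measurable_sets[OF measurable_fst_label[OF P(2)] A])
    have "emeasure (distr (mix_measure s \<pi> \<eta>) borel fst) A = emeasure (mix_measure s \<pi> \<eta>) (fst -` A \<inter> space \<pi>)"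
      using A P(2) by (subst emeasure_distr[OF measurable_fst_label]) auto
    also have "\<dots> = ennreal (1 - s) * emeasure \<pi> (fst -` A \<inter> space \<pi>)
        + ennreal s * emeasure \<eta> (fst -` A \<inter> space \<eta>)"
      using emeasure_mix_measure[OF sets pre, of s] sets_eq_imp_space_eq[OF sets] by simp
    also have "\<dots> = ennreal (1 - s) * emeasure \<xi> A + ennreal s * emeasure \<xi> A"
      using emeasure_distr[OF measurable_fst_label[OF P(2)] A] emeasure_distr[OF measurable_fst_label[OF E(2)] A]
      by (simp add: P(3) E(3))
    finally show "emeasure (distr (mix_measure s \<pi> \<eta>) borel fst) A = emeasure \<xi> A"
      using assms(3,4) by (simp add: mix_weights)
  qed
  ultimately show ?thesis
    using P(2) by (simp add: couplings_def prob_measures_def)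
qed

text \<open>
  With the inner integration over \<open>\<rho>\<close>, Fubini reduces this to linearity of a single integral in
  the measure.
\<close>

lemma integral_pair_mix_measure:
  fixes h :: "'b \<Rightarrow> 'c \<Rightarrow> real"
  assumes fin: "finite_measure N" "finite_measure N'"
    and sub: "submeasure \<mu> N" "submeasure \<nu> N" "submeasure \<rho> N'"
    and h: "integrable (N \<Otimes>\<^sub>M N') (\<lambda>(x, y). h x y)" and s: "0 \<le> s" "s \<le> 1"
  shows "(\<integral>(x, y). h x y \<partial>(mix_measure s \<mu> \<nu> \<Otimes>\<^sub>M \<rho>))
    = (1 - s) * (\<integral>(x, y). h x y \<partial>(\<mu> \<Otimes>\<^sub>M \<rho>)) + s * (\<integral>(x, y). h x y \<partial>(\<nu> \<Otimes>\<^sub>M \<rho>))"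
proof -
  have L: "finite_measure \<rho>"
    using submeasure_finite_measure sub(3) fin(2) .
  have fub: "integrable \<kappa> (\<lambda>x. \<integral>y. h x y \<partial>\<rho>)"
    "(\<integral>(x, y). h x y \<partial>(\<kappa> \<Otimes>\<^sub>M \<rho>)) = (\<integral>x. (\<integral>y. h x y \<partial>\<rho>) \<partial>\<kappa>)" if \<kappa>: "submeasure \<kappa> N" for \<kappa>
  proof -
    interpret pair_sigma_finite \<kappa> \<rho>
      using L submeasure_finite_measure[OF \<kappa> fin(1)]
      by (simp add: pair_sigma_finite_def finite_measure_def)
    have "integrable (\<kappa> \<Otimes>\<^sub>M \<rho>) (\<lambda>(x, y). h x y)"
      by (rule submeasure_integrable[OF submeasure_pair[OF \<kappa> sub(3) fin] h])
    then show "integrable \<kappa> (\<lambda>x. \<integral>y. h x y \<partial>\<rho>)"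
      "(\<integral>(x, y). h x y \<partial>(\<kappa> \<Otimes>\<^sub>M \<rho>)) = (\<integral>x. (\<integral>y. h x y \<partial>\<rho>) \<partial>\<kappa>)"
      by (auto simp: integrable_fst integral_fst)
  qed
  have sets: "sets \<nu> = sets \<mu>"
    using submeasure_sets[OF sub(1)] submeasure_sets[OF sub(2)] by simp
  show ?thesis
    using integral_mix_measure[OF sets fub(1)[OF sub(1)] fub(1)[OF sub(2)] s]
    by (simp add: fub(2)[OF sub(1)] fub(2)[OF sub(2)] fub(2)[OF submeasure_mix_measure[OF sub(1,2) s]])
qed


section \<open>The objective as a bilinear form\<close>

text \<open>
  The common property of couplings and their weak limits (see \<open>submeasure_weak_limit\<close>) that makes
  all integrals of the gauge below well-defined.
\<close>

definition dominated :: "'a::polish_space measure \<Rightarrow> nat \<Rightarrow> ('a \<times> nat) measure \<Rightarrow> bool" where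
  "dominated \<xi> n \<sigma> \<longleftrightarrow> (\<forall>i\<in>{1..n}. submeasure (component \<sigma> i) \<xi>)"

lemma dominatedD: "dominated \<xi> n \<sigma> \<Longrightarrow> i \<in> {1..n} \<Longrightarrow> submeasure (component \<sigma> i) \<xi>"
  by (simp add: dominated_def)

lemma dominated_coupling: "\<sigma> \<in> couplings \<xi> n \<Longrightarrow> dominated \<xi> n \<sigma>"
  by (simp add: dominated_def submeasure_component)

text \<open>
  The bilinear form with \<open>Q_GW(G, \<pi>) = Q_cross(G, \<pi>, \<pi>)\<close>. It also contains the derivative: since
  \<open>c_hat\<close> is the partial integral of the squared deviation (see \<open>sum_integral_c_hat\<close>), the sum in
  the stationarity condition is \<open>Q_cross(G_hat(\<pi>), \<eta>, \<pi>) - Q_GW(G_hat(\<pi>), \<pi>)\<close>.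
\<close>

definition Q_cross ::
  "('a::polish_space \<Rightarrow> 'a \<Rightarrow> real) \<Rightarrow> nat \<Rightarrow> (nat \<Rightarrow> nat \<Rightarrow> real) \<Rightarrow>
     ('a \<times> nat) measure \<Rightarrow> ('a \<times> nat) measure \<Rightarrow> real" where
  "Q_cross g n G \<sigma> \<tau> = (\<Sum>i=1..n. \<Sum>i'=1..n.
     \<integral>(x, x'). (g x x' - G i i')\<^sup>2 \<partial>(component \<sigma> i \<Otimes>\<^sub>M component \<tau> i'))"

lemma Q_GW_eq_Q_cross: "Q_GW g n G \<pi> = Q_cross g n G \<pi> \<pi>"
  by (simp add: Q_GW_def Q_cross_def)

context gm_space
begin

lemma space_xi [simp]: "space \<xi> = UNIV"
  using sets_eq_imp_space_eq[OF sets_xi] by simp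

lemma finite_xi: "finite_measure \<xi>"
  by unfold_locales

lemma submeasure_pair_xi:
  assumes "submeasure \<mu> \<xi>" "submeasure \<nu> \<xi>"
  shows "submeasure (\<mu> \<Otimes>\<^sub>M \<nu>) (\<xi> \<Otimes>\<^sub>M \<xi>)"
  by (rule submeasure_pair[OF assms finite_xi finite_xi])

lemma pair_sigma_finite_submeasures:
  assumes "submeasure \<mu> \<xi>" "submeasure \<nu> \<xi>"
  shows "pair_sigma_finite \<mu> \<nu>"
  using submeasure_finite_measure[OF assms(1) finite_xi] submeasure_finite_measure[OF assms(2) finite_xi]
  by (simp add: pair_sigma_finite_def finite_measure_def)

lemma integrable_gauge: "integrable (\<xi> \<Otimes>\<^sub>M \<xi>) (\<lambda>(x, x'). g x x')"
proof -
  interpret P: finite_measure "\<xi> \<Otimes>\<^sub>M \<xi>"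
    by (rule finite_measure_pair_measure[OF finite_xi finite_xi])
  have "integrable (\<xi> \<Otimes>\<^sub>M \<xi>) (\<lambda>z. (case_prod g z)\<^sup>2)"
    using gauge_square_integrable by (simp add: case_prod_unfold)
  then show ?thesis
    by (rule P.square_integrable_imp_integrable[OF gauge_measurable])
qed

lemma integrable_gauge_deviation: "integrable (\<xi> \<Otimes>\<^sub>M \<xi>) (\<lambda>(x, x'). (g x x' - c)\<^sup>2)"
proof -
  interpret P: finite_measure "\<xi> \<Otimes>\<^sub>M \<xi>"
    by (rule finite_measure_pair_measure[OF finite_xi finite_xi])
  have "integrable (\<xi> \<Otimes>\<^sub>M \<xi>) (\<lambda>z. (case_prod g z)\<^sup>2 - 2 * c * case_prod g z + c\<^sup>2)"
    using gauge_square_integrable integrable_gauge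
    by (intro Bochner_Integration.integrable_add Bochner_Integration.integrable_diff
        Bochner_Integration.integrable_mult_right) (auto simp: case_prod_unfold)
  then show ?thesis
    by (simp add: case_prod_unfold power2_diff algebra_simps)
qed

lemma measure_pair_submeasures:
  assumes \<mu>: "submeasure \<mu> \<xi>" and \<nu>: "submeasure \<nu> \<xi>"
  shows "measure (\<mu> \<Otimes>\<^sub>M \<nu>) (space (\<mu> \<Otimes>\<^sub>M \<nu>)) = measure \<mu> UNIV * measure \<nu> UNIV"
proof -
  interpret N: finite_measure \<nu> by (rule submeasure_finite_measure[OF \<nu> finite_xi])
  have "UNIV \<in> sets \<mu>" "UNIV \<in> sets \<nu>"
    using submeasure_space[OF \<mu>] submeasure_space[OF \<nu>] sets.top[of \<mu>] sets.top[of \<nu>] by simp_all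
  then have "measure (\<mu> \<Otimes>\<^sub>M \<nu>) (UNIV \<times> UNIV) = measure \<mu> UNIV * measure \<nu> UNIV"
    by (simp only: measure_def N.emeasure_pair_measure_Times enn2real_mult)
  moreover have "space (\<mu> \<Otimes>\<^sub>M \<nu>) = UNIV \<times> UNIV"
    by (simp add: space_pair_measure submeasure_space[OF \<mu>] submeasure_space[OF \<nu>])
  ultimately show ?thesis by simp
qed

text \<open>
  This separates the constant \<open>c\<close> from the measures. It yields both the optimality of the mean as
  \<open>c\<close> and the joint continuity in \<open>c\<close> and the measures.
\<close>

lemma integral_gauge_deviation:
  assumes \<mu>: "submeasure \<mu> \<xi>" and \<nu>: "submeasure \<nu> \<xi>"
  shows "(\<integral>(x, x'). (g x x' - c)\<^sup>2 \<partial>(\<mu> \<Otimes>\<^sub>M \<nu>))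
    = (\<integral>(x, x'). (g x x')\<^sup>2 \<partial>(\<mu> \<Otimes>\<^sub>M \<nu>)) - 2 * c * (\<integral>(x, x'). g x x' \<partial>(\<mu> \<Otimes>\<^sub>M \<nu>))
      + c\<^sup>2 * (measure \<mu> UNIV * measure \<nu> UNIV)"
proof -
  note sub = submeasure_pair_xi[OF assms]
  interpret P: finite_measure "\<mu> \<Otimes>\<^sub>M \<nu>"
    by (intro finite_measure_pair_measure submeasure_finite_measure[OF _ finite_xi] assms)
  have int: "integrable (\<mu> \<Otimes>\<^sub>M \<nu>) (\<lambda>z. (case_prod g z)\<^sup>2)" "integrable (\<mu> \<Otimes>\<^sub>M \<nu>) (case_prod g)"
    using submeasure_integrable[OF sub gauge_square_integrable] submeasure_integrable[OF sub integrable_gauge]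
    by (simp_all add: case_prod_unfold)
  have "(\<integral>(x, x'). (g x x' - c)\<^sup>2 \<partial>(\<mu> \<Otimes>\<^sub>M \<nu>))
      = (\<integral>z. (case_prod g z)\<^sup>2 - 2 * c * case_prod g z + c\<^sup>2 \<partial>(\<mu> \<Otimes>\<^sub>M \<nu>))"
    by (simp add: case_prod_unfold power2_diff algebra_simps)
  also have "\<dots> = (\<integral>z. (case_prod g z)\<^sup>2 \<partial>(\<mu> \<Otimes>\<^sub>M \<nu>)) - 2 * c * (\<integral>z. case_prod g z \<partial>(\<mu> \<Otimes>\<^sub>M \<nu>))
      + c\<^sup>2 * measure (\<mu> \<Otimes>\<^sub>M \<nu>) (space (\<mu> \<Otimes>\<^sub>M \<nu>))"
    using int by simp
  finally show ?thesis
    by (simp only: measure_pair_submeasures[OF \<mu> \<nu>]) (simp add: case_prod_unfold)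
qed

text \<open>
  The gauge is symmetric only almost everywhere for \<open>\<xi> \<otimes> \<xi>\<close>; the exceptional set is null for every
  product of sub-measures of \<open>\<xi>\<close>.
\<close>

lemma integral_gauge_swap:
  fixes \<phi> :: "real \<Rightarrow> real"
  assumes \<mu>: "submeasure \<mu> \<xi>" and \<nu>: "submeasure \<nu> \<xi>" and [measurable]: "\<phi> \<in> borel_measurable borel"
  shows "(\<integral>(x, x'). \<phi> (g x x') \<partial>(\<mu> \<Otimes>\<^sub>M \<nu>)) = (\<integral>(x, x'). \<phi> (g x x') \<partial>(\<nu> \<Otimes>\<^sub>M \<mu>))"
proof -
  interpret pair_sigma_finite \<nu> \<mu> by (rule pair_sigma_finite_submeasures[OF \<nu> \<mu>])
  have meas: "case_prod g \<in> borel_measurable (\<mu> \<Otimes>\<^sub>M \<nu>)" "case_prod g \<in> borel_measurable (\<nu> \<Otimes>\<^sub>M \<mu>)"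
    by (rule submeasure_measurable[OF submeasure_pair_xi gauge_measurable], fact, fact)+
  have comp: "(\<lambda>z. \<phi> (case_prod g z)) \<in> borel_measurable (\<nu> \<Otimes>\<^sub>M \<mu>)"
    "(\<lambda>z. \<phi> (case_prod g z)) \<in> borel_measurable (\<mu> \<Otimes>\<^sub>M \<nu>)"
    using measurable_compose[OF meas(2) assms(3)] measurable_compose[OF meas(1) assms(3)] by simp_all
  have "(\<integral>(x, x'). \<phi> (g x x') \<partial>(\<nu> \<Otimes>\<^sub>M \<mu>)) = (\<integral>(x, x'). \<phi> (g x' x) \<partial>(\<mu> \<Otimes>\<^sub>M \<nu>))"
    using integral_product_swap[OF comp(1)] by (simp add: case_prod_unfold)
  also have "\<dots> = (\<integral>(x, x'). \<phi> (g x x') \<partial>(\<mu> \<Otimes>\<^sub>M \<nu>))"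
  proof (rule integral_cong_AE)
    show "AE z in \<mu> \<Otimes>\<^sub>M \<nu>. (case z of (x, x') \<Rightarrow> \<phi> (g x' x)) = (case z of (x, x') \<Rightarrow> \<phi> (g x x'))"
      using submeasure_AE[OF submeasure_pair_xi[OF \<mu> \<nu>] gauge_symmetric]
      by eventually_elim auto
    show "(\<lambda>(x, x'). \<phi> (g x x')) \<in> borel_measurable (\<mu> \<Otimes>\<^sub>M \<nu>)"
      using comp(2) by (simp add: case_prod_unfold)
    show "(\<lambda>(x, x'). \<phi> (g x' x)) \<in> borel_measurable (\<mu> \<Otimes>\<^sub>M \<nu>)"
      using measurable_compose[OF measurable_pair_swap' comp(1)] by (simp add: case_prod_unfold)
  qed
  finally show ?thesis ..
qed

lemma G_hat_symmetric:
  assumes "dominated \<xi> n \<pi>" "i \<in> {1..n}" "j \<in> {1..n}"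
  shows "G_hat g \<pi> i j = G_hat g \<pi> j i"
  using integral_gauge_swap[OF dominatedD[OF assms(1,2)] dominatedD[OF assms(1,3)], of "\<lambda>x. x"]
  by (simp add: G_hat_def mult.commute)

lemma Q_cross_commute:
  assumes \<sigma>: "dominated \<xi> n \<sigma>" and \<tau>: "dominated \<xi> n \<tau>"
    and G: "\<And>i j. i \<in> {1..n} \<Longrightarrow> j \<in> {1..n} \<Longrightarrow> G i j = G j i"
  shows "Q_cross g n G \<sigma> \<tau> = Q_cross g n G \<tau> \<sigma>"
proof -
  have "Q_cross g n G \<sigma> \<tau> = (\<Sum>i'=1..n. \<Sum>i=1..n.
     \<integral>(x, x'). (g x x' - G i i')\<^sup>2 \<partial>(component \<sigma> i \<Otimes>\<^sub>M component \<tau> i'))"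
    unfolding Q_cross_def by (rule sum.swap)
  also have "\<dots> = (\<Sum>i'=1..n. \<Sum>i=1..n.
     \<integral>(x, x'). (g x x' - G i' i)\<^sup>2 \<partial>(component \<tau> i' \<Otimes>\<^sub>M component \<sigma> i))"
  proof (intro sum.cong refl)
    fix i' i assume i: "i' \<in> {1..n}" "i \<in> {1..n}"
    show "(\<integral>(x, x'). (g x x' - G i i')\<^sup>2 \<partial>(component \<sigma> i \<Otimes>\<^sub>M component \<tau> i'))
      = (\<integral>(x, x'). (g x x' - G i' i)\<^sup>2 \<partial>(component \<tau> i' \<Otimes>\<^sub>M component \<sigma> i))"
      using integral_gauge_swap[OF dominatedD[OF \<sigma> i(2)] dominatedD[OF \<tau> i(1)], of "\<lambda>y. (y - G i i')\<^sup>2"]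
        G[OF i] by simp
  qed
  finally show ?thesis by (simp add: Q_cross_def)
qed

lemma Q_cross_mix_left:
  assumes \<pi>: "\<pi> \<in> couplings \<xi> n" and \<eta>: "\<eta> \<in> couplings \<xi> n" and \<tau>: "dominated \<xi> n \<tau>"
    and s: "0 \<le> s" "s \<le> 1"
  shows "Q_cross g n G (mix_measure s \<pi> \<eta>) \<tau> = (1 - s) * Q_cross g n G \<pi> \<tau> + s * Q_cross g n G \<eta> \<tau>"
proof -
  have "Q_cross g n G (mix_measure s \<pi> \<eta>) \<tau> = (\<Sum>i=1..n. \<Sum>i'=1..n.
     (1 - s) * (\<integral>(x, x'). (g x x' - G i i')\<^sup>2 \<partial>(component \<pi> i \<Otimes>\<^sub>M component \<tau> i'))
     + s * (\<integral>(x, x'). (g x x' - G i i')\<^sup>2 \<partial>(component \<eta> i \<Otimes>\<^sub>M component \<tau> i')))"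
    unfolding Q_cross_def
  proof (intro sum.cong refl)
    fix i i' assume i: "i \<in> {1..n}" "i' \<in> {1..n}"
    show "(\<integral>(x, x'). (g x x' - G i i')\<^sup>2 \<partial>(component (mix_measure s \<pi> \<eta>) i \<Otimes>\<^sub>M component \<tau> i'))
      = (1 - s) * (\<integral>(x, x'). (g x x' - G i i')\<^sup>2 \<partial>(component \<pi> i \<Otimes>\<^sub>M component \<tau> i'))
       + s * (\<integral>(x, x'). (g x x' - G i i')\<^sup>2 \<partial>(component \<eta> i \<Otimes>\<^sub>M component \<tau> i'))"
      unfolding component_mix_measure[OF couplingsD(2)[OF \<pi>] couplingsD(2)[OF \<eta>] i(1)]
      by (rule integral_pair_mix_measure[OF finite_xi finite_xi submeasure_component[OF \<pi> i(1)]
            submeasure_component[OF \<eta> i(1)] dominatedD[OF \<tau> i(2)] integrable_gauge_deviation s])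
  qed
  then show ?thesis
    by (simp add: Q_cross_def sum.distrib sum_distrib_left)
qed

text \<open>
  The exact quadratic expansion along the segment. The symmetry of \<open>G\<close> and of the gauge merges
  the two mixed terms.
\<close>

lemma Q_GW_mix:
  assumes \<pi>: "\<pi> \<in> couplings \<xi> n" and \<eta>: "\<eta> \<in> couplings \<xi> n" and s: "0 \<le> s" "s \<le> 1"
    and G: "\<And>i j. i \<in> {1..n} \<Longrightarrow> j \<in> {1..n} \<Longrightarrow> G i j = G j i"
  shows "Q_GW g n G (mix_measure s \<pi> \<eta>)
    = Q_GW g n G \<pi> + 2 * s * (Q_cross g n G \<eta> \<pi> - Q_GW g n G \<pi>)
      + s\<^sup>2 * (Q_GW g n G \<pi> - 2 * Q_cross g n G \<eta> \<pi> + Q_GW g n G \<eta>)"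
proof -
  note dom = dominated_coupling[OF \<pi>] dominated_coupling[OF \<eta>] dominated_coupling[OF mix_measure_coupling[OF \<pi> \<eta> s]]
  have "Q_GW g n G (mix_measure s \<pi> \<eta>)
      = (1 - s) * Q_cross g n G (mix_measure s \<pi> \<eta>) \<pi> + s * Q_cross g n G (mix_measure s \<pi> \<eta>) \<eta>"
    unfolding Q_GW_eq_Q_cross Q_cross_mix_left[OF \<pi> \<eta> dom(3) s]
    using Q_cross_commute[OF dom(1,3) G] Q_cross_commute[OF dom(2,3) G] by simp
  also have "\<dots> = (1 - s) * ((1 - s) * Q_GW g n G \<pi> + s * Q_cross g n G \<eta> \<pi>)
      + s * ((1 - s) * Q_cross g n G \<eta> \<pi> + s * Q_GW g n G \<eta>)"
    using Q_cross_commute[OF dom(1,2) G] Q_cross_mix_left[OF \<pi> \<eta> dom(1) s, of G]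
      Q_cross_mix_left[OF \<pi> \<eta> dom(2) s, of G]
    by (simp add: Q_GW_eq_Q_cross)
  finally show ?thesis
    by (simp add: power2_eq_square algebra_simps)
qed

text \<open>
  The entries of \<open>G_hat(\<pi>)\<close> are the means of the gauge for the products of components, and a mean
  minimises the squared deviation: the two sides differ by \<open>m \<cdot> (G_hat - G)\<^sup>2\<close> in each entry, where
  \<open>m\<close> is the mass of the product.
\<close>

lemma Q_GW_G_hat_le:
  assumes \<pi>: "dominated \<xi> n \<pi>" and pos: "\<And>i. i \<in> {1..n} \<Longrightarrow> measure (component \<pi> i) UNIV > 0"
  shows "Q_GW g n (G_hat g \<pi>) \<pi> \<le> Q_GW g n G \<pi>"
  unfolding Q_GW_def
proof (intro sum_mono)
  fix i i' assume i: "i \<in> {1..n}" "i' \<in> {1..n}"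
  define m where "m = measure (component \<pi> i) UNIV * measure (component \<pi> i') UNIV"
  define J where "J = (\<integral>(x, x'). g x x' \<partial>(component \<pi> i \<Otimes>\<^sub>M component \<pi> i'))"
  have m: "m > 0" using pos i by (simp add: m_def)
  have J: "J = m * G_hat g \<pi> i i'"
    using m by (simp add: G_hat_def flip: m_def J_def)
  have "0 \<le> m * (G_hat g \<pi> i i' - G i i')\<^sup>2" using m by simp
  then show "(\<integral>(x, x'). (g x x' - G_hat g \<pi> i i')\<^sup>2 \<partial>(component \<pi> i \<Otimes>\<^sub>M component \<pi> i'))
    \<le> (\<integral>(x, x'). (g x x' - G i i')\<^sup>2 \<partial>(component \<pi> i \<Otimes>\<^sub>M component \<pi> i'))"
    unfolding integral_gauge_deviation[OF dominatedD[OF \<pi> i(1)] dominatedD[OF \<pi> i(2)]]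
    by (simp flip: m_def J_def) (simp add: J power2_eq_square algebra_simps)
qed

lemma Q_cross_nonneg: "0 \<le> Q_cross g n G \<sigma> \<tau>"
  unfolding Q_cross_def by (intro sum_nonneg Bochner_Integration.integral_nonneg) auto

lemma sum_mass_coupling:
  assumes "\<pi> \<in> couplings \<xi> n"
  shows "(\<Sum>i=1..n. measure (component \<pi> i) UNIV) = 1"
  using sum_integral_component[OF assms, of "\<lambda>_. 1"] prob_space by simp

lemma abs_integral_pair_le:
  fixes h :: "'a \<times> 'a \<Rightarrow> real"
  assumes \<mu>: "submeasure \<mu> \<xi>" and \<nu>: "submeasure \<nu> \<xi>"
    and h: "integrable (\<xi> \<Otimes>\<^sub>M \<xi>) h" "AE z in \<xi> \<Otimes>\<^sub>M \<xi>. \<bar>h z\<bar> \<le> B"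
  shows "\<bar>\<integral>z. h z \<partial>(\<mu> \<Otimes>\<^sub>M \<nu>)\<bar> \<le> B * (measure \<mu> UNIV * measure \<nu> UNIV)"
proof -
  note sub = submeasure_pair_xi[OF \<mu> \<nu>]
  interpret P: finite_measure "\<mu> \<Otimes>\<^sub>M \<nu>"
    by (intro finite_measure_pair_measure submeasure_finite_measure[OF _ finite_xi] \<mu> \<nu>)
  have "\<bar>\<integral>z. h z \<partial>(\<mu> \<Otimes>\<^sub>M \<nu>)\<bar> \<le> (\<integral>z. \<bar>h z\<bar> \<partial>(\<mu> \<Otimes>\<^sub>M \<nu>))"
    by (rule integral_abs_bound)
  also have "\<dots> \<le> (\<integral>z. B \<partial>(\<mu> \<Otimes>\<^sub>M \<nu>))"
    using submeasure_integrable[OF sub h(1)] submeasure_AE[OF sub h(2)]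
    by (intro integral_mono_AE) auto
  also have "\<dots> = B * (measure \<mu> UNIV * measure \<nu> UNIV)"
    by (simp add: measure_pair_submeasures[OF \<mu> \<nu>] mult_ac)
  finally show ?thesis .
qed

text \<open>
  The constant does not depend on the iterate, which makes the curvature in the line search
  uniformly bounded. The entries of \<open>G_hat(\<pi>)\<close> are means of a function bounded by \<open>B\<close>, so
  deviations are at most \<open>2B\<close>, and the total mass is 1.
\<close>

lemma Q_GW_G_hat_bound:
  assumes \<pi>: "dominated \<xi> n \<pi>" and pos: "\<And>i. i \<in> {1..n} \<Longrightarrow> measure (component \<pi> i) UNIV > 0"
    and \<eta>: "\<eta> \<in> couplings \<xi> n" and B: "AE (x, x') in \<xi> \<Otimes>\<^sub>M \<xi>. \<bar>g x x'\<bar> \<le> B"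
  shows "Q_GW g n (G_hat g \<pi>) \<eta> \<le> 4 * B\<^sup>2"
proof -
  note dom = dominated_coupling[OF \<eta>]
  have G: "\<bar>G_hat g \<pi> i i'\<bar> \<le> B" if i: "i \<in> {1..n}" "i' \<in> {1..n}" for i i'
  proof -
    define m where "m = measure (component \<pi> i) UNIV * measure (component \<pi> i') UNIV"
    have m: "m > 0" using pos i by (simp add: m_def)
    have "\<bar>\<integral>(x, x'). g x x' \<partial>(component \<pi> i \<Otimes>\<^sub>M component \<pi> i')\<bar> \<le> B * m"
      unfolding m_def using B
      by (intro abs_integral_pair_le dominatedD[OF \<pi>] i integrable_gauge) (auto simp: case_prod_unfold)
    then show ?thesis
      using m by (simp add: G_hat_def abs_mult divide_le_eq flip: m_def)
  qed
  have "Q_GW g n (G_hat g \<pi>) \<eta> \<le> (\<Sum>i=1..n. \<Sum>i'=1..n.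
      4 * B\<^sup>2 * (measure (component \<eta> i) UNIV * measure (component \<eta> i') UNIV))"
    unfolding Q_GW_def
  proof (intro sum_mono)
    fix i i' assume i: "i \<in> {1..n}" "i' \<in> {1..n}"
    have "AE z in \<xi> \<Otimes>\<^sub>M \<xi>. \<bar>case z of (x, x') \<Rightarrow> (g x x' - G_hat g \<pi> i i')\<^sup>2\<bar> \<le> 4 * B\<^sup>2"
      using B
    proof eventually_elim
      case (elim z)
      obtain x x' where z: "z = (x, x')" by (cases z)
      have "\<bar>g x x' - G_hat g \<pi> i i'\<bar> \<le> 2 * B"
        using elim G[OF i] by (simp add: z)
      then have "(g x x' - G_hat g \<pi> i i')\<^sup>2 \<le> (2 * B)\<^sup>2"
        by (metis abs_ge_zero power2_abs power_mono)
      then show ?case by (simp add: z power_mult_distrib)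
    qed
    from abs_integral_pair_le[OF dominatedD[OF dom i(1)] dominatedD[OF dom i(2)] integrable_gauge_deviation this]
    show "(\<integral>(x, x'). (g x x' - G_hat g \<pi> i i')\<^sup>2 \<partial>(component \<eta> i \<Otimes>\<^sub>M component \<eta> i'))
      \<le> 4 * B\<^sup>2 * (measure (component \<eta> i) UNIV * measure (component \<eta> i') UNIV)"
      by linarith
  qed
  also have "\<dots> = 4 * B\<^sup>2 * ((\<Sum>i=1..n. measure (component \<eta> i) UNIV) * (\<Sum>i'=1..n. measure (component \<eta> i') UNIV))"
    unfolding sum_product by (simp only: sum_distrib_left)
  finally show ?thesis by (simp only: sum_mass_coupling[OF \<eta>] mult_1_right)
qed

end


section \<open>Optimality of the Voronoi partition\<close>

lemma voronoi_label_in: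
  assumes "n \<ge> 1"
  shows "voronoi_label n c x \<in> {1..n}"
    and "c (voronoi_label n c x) x = Min ((\<lambda>j. c j x) ` {1..n})"
proof -
  have "Min ((\<lambda>j. c j x) ` {1..n}) \<in> (\<lambda>j. c j x) ` {1..n}"
    using assms by (intro Min_in) auto
  then have "{i \<in> {1..n}. c i x = Min ((\<lambda>j. c j x) ` {1..n})} \<noteq> {}"
    by auto
  then have "voronoi_label n c x \<in> {i \<in> {1..n}. c i x = Min ((\<lambda>j. c j x) ` {1..n})}"
    unfolding voronoi_label_def by (intro Min_in) auto
  then show "voronoi_label n c x \<in> {1..n}" "c (voronoi_label n c x) x = Min ((\<lambda>j. c j x) ` {1..n})"
    by auto
qed

lemma voronoi_label_le:
  assumes "i \<in> {1..n}"
  shows "c (voronoi_label n c x) x \<le> c i x"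
  using assms by (subst voronoi_label_in(2)) (auto intro!: Min_le)

text \<open>
  Spelled out with finitely many comparisons, which shows that the cells are measurable.
\<close>

lemma voronoi_cell_eq:
  assumes i: "i \<in> {1..n}"
  shows "voronoi_cell n c i = {x. (\<forall>j\<in>{1..n}. c i x \<le> c j x) \<and> (\<forall>j\<in>{1..<i}. c i x < c j x)}"
proof -
  have "voronoi_label n c x = i \<longleftrightarrow> (\<forall>j\<in>{1..n}. c i x \<le> c j x) \<and> (\<forall>j\<in>{1..<i}. c i x < c j x)" for x
  proof -
    define S where "S = {j \<in> {1..n}. c j x = Min ((\<lambda>j. c j x) ` {1..n})}"
    have n: "n \<ge> 1" using i by auto
    have S: "j \<in> S \<longleftrightarrow> j \<in> {1..n} \<and> (\<forall>l\<in>{1..n}. c j x \<le> c l x)" for j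
      using n by (auto simp: S_def eq_commute[of "c j x"] Min_eq_iff)
    have in_S: "voronoi_label n c x \<in> S"
      using voronoi_label_in[OF n, of c x] by (simp add: S_def)
    have least: "voronoi_label n c x \<le> j" if "j \<in> S" for j
      using that unfolding voronoi_label_def S_def[symmetric] by (intro Min_le) (auto simp: S_def)
    show ?thesis
    proof
      assume eq: "voronoi_label n c x = i"
      have "c i x < c j x" if "j \<in> {1..<i}" for j
      proof (rule ccontr)
        assume "\<not> c i x < c j x"
        then have "j \<in> S" using in_S that i by (force simp: eq S)
        then show False using least[of j] that by (simp add: eq)
      qed
      then show "(\<forall>j\<in>{1..n}. c i x \<le> c j x) \<and> (\<forall>j\<in>{1..<i}. c i x < c j x)"
        using in_S by (simp add: eq S)
    next
      assume R: "(\<forall>j\<in>{1..n}. c i x \<le> c j x) \<and> (\<forall>j\<in>{1..<i}. c i x < c j x)"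
      then have "voronoi_label n c x \<le> i" using i by (intro least) (simp add: S)
      moreover have "\<not> voronoi_label n c x < i"
      proof
        assume "voronoi_label n c x < i"
        moreover have "voronoi_label n c x \<ge> 1" using in_S by (simp add: S)
        ultimately have "c i x < c (voronoi_label n c x) x" using R by simp
        then show False using in_S i by (auto simp: S not_less[symmetric])
      qed
      ultimately show "voronoi_label n c x = i" by simp
    qed
  qed
  then show ?thesis by (auto simp: voronoi_cell_def)
qed

lemma voronoi_cell_measurable:
  fixes c :: "nat \<Rightarrow> 'a::topological_space \<Rightarrow> real"
  assumes i: "i \<in> {1..n}" and c: "\<And>j. j \<in> {1..n} \<Longrightarrow> c j \<in> borel_measurable borel"
  shows "voronoi_cell n c i \<in> sets borel"
proof -
  have "voronoi_cell n c i
      = (\<Inter>j\<in>{1..n}. {x. c i x \<le> c j x}) \<inter> ((\<Inter>j\<in>{1..<i}. {x. c i x < c j x}) \<inter> UNIV)"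
    by (auto simp: voronoi_cell_eq[OF i])
  moreover have "{x. c i x \<le> c j x} \<in> sets borel" if "j \<in> {1..n}" for j
    using borel_measurable_le[OF c[OF i] c[OF that]] by simp
  then have "(\<Inter>j\<in>{1..n}. {x. c i x \<le> c j x}) \<in> sets borel"
    using i by (intro sets.finite_INT) auto
  moreover have "{x. c i x < c j x} \<in> sets borel" if "j \<in> {1..<i}" for j
    using borel_measurable_less[OF c[OF i] c[of j]] that i by simp
  then have "(\<Inter>j\<in>{1..<i}. {x. c i x < c j x}) \<inter> UNIV \<in> sets borel"
    using i by (cases "i = 1") (auto intro!: sets.finite_INT)
  ultimately show ?thesis by simp
qed

context gm_space
begin

lemma borel_measurable_xi: "f \<in> borel_measurable \<xi> \<longleftrightarrow> f \<in> borel_measurable borel"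
  using measurable_cong_sets[OF sets_xi refl] by blast

lemma integrable_integral_deviation:
  assumes "submeasure \<mu> \<xi>" "submeasure \<nu> \<xi>"
  shows "integrable \<mu> (\<lambda>x. \<integral>x'. (g x x' - c)\<^sup>2 \<partial>\<nu>)"
    and "(\<integral>x. (\<integral>x'. (g x x' - c)\<^sup>2 \<partial>\<nu>) \<partial>\<mu>) = (\<integral>(x, x'). (g x x' - c)\<^sup>2 \<partial>(\<mu> \<Otimes>\<^sub>M \<nu>))"
proof -
  interpret pair_sigma_finite \<mu> \<nu> by (rule pair_sigma_finite_submeasures[OF assms])
  have "integrable (\<mu> \<Otimes>\<^sub>M \<nu>) (\<lambda>(x, x'). (g x x' - c)\<^sup>2)"
    by (rule submeasure_integrable[OF submeasure_pair_xi[OF assms] integrable_gauge_deviation])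
  then show "integrable \<mu> (\<lambda>x. \<integral>x'. (g x x' - c)\<^sup>2 \<partial>\<nu>)"
    "(\<integral>x. (\<integral>x'. (g x x' - c)\<^sup>2 \<partial>\<nu>) \<partial>\<mu>) = (\<integral>(x, x'). (g x x' - c)\<^sup>2 \<partial>(\<mu> \<Otimes>\<^sub>M \<nu>))"
    by (auto simp: integrable_fst integral_fst)
qed

lemma integrable_c_hat:
  assumes "dominated \<xi> n \<pi>"
  shows "integrable \<xi> (c_hat g n \<pi> i)"
  unfolding c_hat_def
  by (intro Bochner_Integration.integrable_sum integrable_integral_deviation(1) submeasure_refl dominatedD[OF assms])

lemma sum_integral_c_hat:
  assumes \<pi>: "dominated \<xi> n \<pi>" and \<sigma>: "dominated \<xi> n \<sigma>"
  shows "(\<Sum>i=1..n. \<integral>x. c_hat g n \<pi> i x \<partial>(component \<sigma> i)) = Q_cross g n (G_hat g \<pi>) \<sigma> \<pi>"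
  unfolding Q_cross_def
proof (intro sum.cong refl)
  fix i assume i: "i \<in> {1..n}"
  show "(\<integral>x. c_hat g n \<pi> i x \<partial>(component \<sigma> i)) = (\<Sum>i'=1..n.
      \<integral>(x, x'). (g x x' - G_hat g \<pi> i i')\<^sup>2 \<partial>(component \<sigma> i \<Otimes>\<^sub>M component \<pi> i'))"
    unfolding c_hat_def
    using integrable_integral_deviation[OF dominatedD[OF \<sigma> i] dominatedD[OF \<pi>]]
    by (simp add: Bochner_Integration.integral_sum)
qed

text \<open>
  The Voronoi partition solves the linearised problem. Any coupling pays at least the pointwise
  minimum \<open>m\<close> of the costs, whose integral \<open>\<integral>m d\<xi>\<close> is the same for all couplings, and the Voronoi
  coupling pays exactly this.
\<close>

lemma Q_cross_voronoi_le:
  assumes \<pi>: "dominated \<xi> n \<pi>" and V: "V \<in> couplings \<xi> n" and \<eta>: "\<eta> \<in> couplings \<xi> n" and n: "n \<ge> 1"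
    and V_comp: "\<And>i. i \<in> {1..n} \<Longrightarrow> component V i = density \<xi> (indicator (voronoi_cell n (c_hat g n \<pi>) i))"
  shows "Q_cross g n (G_hat g \<pi>) V \<pi> \<le> Q_cross g n (G_hat g \<pi>) \<eta> \<pi>"
proof -
  define c where "c = c_hat g n \<pi>"
  define m where "m x = c (voronoi_label n c x) x" for x
  have c_int: "integrable \<xi> (c i)" for i
    unfolding c_def by (rule integrable_c_hat[OF \<pi>])
  have c_borel: "c i \<in> borel_measurable borel" for i
    using borel_measurable_integrable[OF c_int] by (simp add: borel_measurable_xi)
  have cell: "voronoi_cell n c i \<in> sets \<xi>" if "i \<in> {1..n}" for i
    using voronoi_cell_measurable[OF that c_borel] by (simp add: sets_xi)
  have m_sum: "m x = (\<Sum>i=1..n. indicator (voronoi_cell n c i) x * c i x)" for x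
  proof -
    have "(\<Sum>i=1..n. indicator (voronoi_cell n c i) x * c i x)
        = (\<Sum>i=1..n. if voronoi_label n c x = i then c i x else 0)"
      by (intro sum.cong refl) (auto simp: voronoi_cell_def)
    then show ?thesis
      using voronoi_label_in(1)[OF n, of c x] by (simp add: m_def)
  qed
  have cell_int: "integrable \<xi> (\<lambda>x. indicator (voronoi_cell n c i) x * c i x)" if "i \<in> {1..n}" for i
    using integrable_mult_indicator[OF cell[OF that] c_int[of i]] by simp
  have m_int: "integrable \<xi> m"
    unfolding m_sum[abs_def] by (intro Bochner_Integration.integrable_sum cell_int)
  have "Q_cross g n (G_hat g \<pi>) V \<pi> = (\<Sum>i=1..n. \<integral>x. c i x \<partial>(component V i))"
    unfolding c_def by (rule sum_integral_c_hat[OF \<pi> dominated_coupling[OF V], symmetric])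
  also have "\<dots> = (\<Sum>i=1..n. \<integral>x. indicator (voronoi_cell n c i) x * c i x \<partial>\<xi>)"
  proof (intro sum.cong refl)
    fix i assume i: "i \<in> {1..n}"
    have "component V i = density \<xi> (\<lambda>x. ennreal (indicator (voronoi_cell n c i) x))"
      using V_comp[OF i] by (simp add: ennreal_indicator c_def)
    then show "(\<integral>x. c i x \<partial>(component V i)) = (\<integral>x. indicator (voronoi_cell n c i) x * c i x \<partial>\<xi>)"
      using cell[OF i] borel_measurable_integrable[OF c_int[of i]] by (simp add: integral_density)
  qed
  also have "\<dots> = (\<integral>x. m x \<partial>\<xi>)"
    unfolding m_sum using cell_int by (intro Bochner_Integration.integral_sum[symmetric])
  \<comment> \<open>All couplings have the marginal \<open>\<xi>\<close>, so they agree on integrands without label.\<close>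
  also have "\<dots> = (\<Sum>i=1..n. \<integral>x. m x \<partial>(component \<eta> i))"
    by (rule sum_integral_component[OF \<eta> m_int, symmetric])
  also have "\<dots> \<le> (\<Sum>i=1..n. \<integral>x. c i x \<partial>(component \<eta> i))"
    by (intro sum_mono integral_mono submeasure_integrable[OF submeasure_component[OF \<eta>]] m_int c_int)
      (auto simp: m_def intro!: voronoi_label_le)
  also have "\<dots> = Q_cross g n (G_hat g \<pi>) \<eta> \<pi>"
    unfolding c_def by (rule sum_integral_c_hat[OF \<pi> dominated_coupling[OF \<eta>]])
  finally show ?thesis .
qed


section \<open>Continuity of the objective\<close>

text \<open>
  The masses of the limit must be positive here: otherwise the quotients defining \<open>G_hat\<close> need
  not converge.
\<close>

lemma G_hat_tendsto:
  assumes P: "\<And>k. dominated \<xi> n (P k)" and Q: "dominated \<xi> n Q"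
    and conv: "\<And>i. i \<in> {1..n} \<Longrightarrow> L1_converges \<xi> (\<lambda>k. component (P k) i) (component Q i)"
    and pos: "\<And>i. i \<in> {1..n} \<Longrightarrow> measure (component Q i) UNIV > 0"
    and i: "i \<in> {1..n}" "i' \<in> {1..n}"
  shows "(\<lambda>k. G_hat g (P k) i i') \<longlonglongrightarrow> G_hat g Q i i'"
proof -
  have mass: "(\<lambda>k. measure (component (P k) j) UNIV) \<longlonglongrightarrow> measure (component Q j) UNIV" if "j \<in> {1..n}" for j
    using L1_convergesD[OF conv[OF that], of "\<lambda>_. 1"] by simp
  have "(\<lambda>k. \<integral>(x, x'). g x x' \<partial>(component (P k) i \<Otimes>\<^sub>M component (P k) i'))
      \<longlonglongrightarrow> (\<integral>(x, x'). g x x' \<partial>(component Q i \<Otimes>\<^sub>M component Q i'))"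
    by (rule L1_convergesD[OF L1_converges_pair integrable_gauge])
      (intro finite_xi conv i dominatedD[OF P] dominatedD[OF Q])+
  then show ?thesis
    unfolding G_hat_def using mass[OF i(1)] mass[OF i(2)] pos[OF i(1)] pos[OF i(2)]
    by (intro tendsto_mult tendsto_divide tendsto_const) auto
qed

lemma Q_cross_tendsto:
  assumes S: "\<And>k. dominated \<xi> n (S k)" and T: "dominated \<xi> n T"
    and P: "\<And>k. dominated \<xi> n (P k)" and Q: "dominated \<xi> n Q"
    and conv_S: "\<And>i. i \<in> {1..n} \<Longrightarrow> L1_converges \<xi> (\<lambda>k. component (S k) i) (component T i)"
    and conv_P: "\<And>i. i \<in> {1..n} \<Longrightarrow> L1_converges \<xi> (\<lambda>k. component (P k) i) (component Q i)"
    and G: "\<And>i i'. i \<in> {1..n} \<Longrightarrow> i' \<in> {1..n} \<Longrightarrow> (\<lambda>k. G k i i') \<longlonglongrightarrow> G' i i'"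
  shows "(\<lambda>k. Q_cross g n (G k) (S k) (P k)) \<longlonglongrightarrow> Q_cross g n G' T Q"
  unfolding Q_cross_def
proof (intro tendsto_sum)
  fix i i' assume i: "i \<in> {1..n}" "i' \<in> {1..n}"
  have pair: "L1_converges (\<xi> \<Otimes>\<^sub>M \<xi>) (\<lambda>k. component (S k) i \<Otimes>\<^sub>M component (P k) i') (component T i \<Otimes>\<^sub>M component Q i')"
    by (rule L1_converges_pair) (intro finite_xi conv_S conv_P i dominatedD[OF S] dominatedD[OF T]
        dominatedD[OF P] dominatedD[OF Q])+
  have mass: "(\<lambda>k. measure (component (S k) i) UNIV) \<longlonglongrightarrow> measure (component T i) UNIV"
    "(\<lambda>k. measure (component (P k) i') UNIV) \<longlonglongrightarrow> measure (component Q i') UNIV"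
    using L1_convergesD[OF conv_S[OF i(1)], of "\<lambda>_. 1"] L1_convergesD[OF conv_P[OF i(2)], of "\<lambda>_. 1"] by simp_all
  show "(\<lambda>k. \<integral>(x, x'). (g x x' - G k i i')\<^sup>2 \<partial>(component (S k) i \<Otimes>\<^sub>M component (P k) i'))
      \<longlonglongrightarrow> (\<integral>(x, x'). (g x x' - G' i i')\<^sup>2 \<partial>(component T i \<Otimes>\<^sub>M component Q i'))"
    unfolding integral_gauge_deviation[OF dominatedD[OF S i(1)] dominatedD[OF P i(2)]]
      integral_gauge_deviation[OF dominatedD[OF T i(1)] dominatedD[OF Q i(2)]]
    by (intro tendsto_intros mass G i L1_convergesD[OF pair] integrable_gauge gauge_square_integrable)
qed


section \<open>Sufficient decrease and stationarity\<close>

text \<open>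
  The sufficient decrease. Updating \<open>G_hat\<close> after the step only lowers the value, the line search
  does at least as well as any fixed \<open>s\<close>, the Voronoi direction has a slope no larger than the
  direction of any \<open>\<eta>\<close>, and the curvature is at most \<open>2 \<cdot> 4B\<^sup>2\<close> because the mixed term in it has
  the favourable sign.
\<close>

lemma cond_gradient_step_decrease:
  assumes \<pi>: "\<pi> \<in> couplings \<xi> n" and step: "cond_gradient_step \<xi> g n \<pi> \<pi>'" and n: "n \<ge> 1"
    and pos: "\<And>i. i \<in> {1..n} \<Longrightarrow> measure (component \<pi> i) UNIV > 0"
    and pos': "\<And>i. i \<in> {1..n} \<Longrightarrow> measure (component \<pi>' i) UNIV > 0"
    and B: "AE (x, x') in \<xi> \<Otimes>\<^sub>M \<xi>. \<bar>g x x'\<bar> \<le> B"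
    and \<eta>: "\<eta> \<in> couplings \<xi> n" and s: "0 \<le> s" "s \<le> 1"
  shows "Q_GW g n (G_hat g \<pi>') \<pi>' \<le> Q_GW g n (G_hat g \<pi>) \<pi>
    + 2 * s * (Q_cross g n (G_hat g \<pi>) \<eta> \<pi> - Q_GW g n (G_hat g \<pi>) \<pi>) + 8 * B\<^sup>2 * s\<^sup>2"
proof -
  define G where "G = G_hat g \<pi>"
  obtain V t where V: "V \<in> couplings \<xi> n"
    and V_comp: "\<And>i. i \<in> {1..n} \<Longrightarrow> component V i = density \<xi> (indicator (voronoi_cell n (c_hat g n \<pi>) i))"
    and t: "is_arg_min (\<lambda>s. Q_GW g n G (mix_measure s \<pi> V)) (\<lambda>s. s \<in> {0..1}) t"
    and \<pi>': "\<pi>' = mix_measure t \<pi> V"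
    using step unfolding cond_gradient_step_def G_def by blast
  have t01: "0 \<le> t" "t \<le> 1" using t by (auto simp: is_arg_min_def)
  note dom = dominated_coupling[OF \<pi>]
  have G_sym: "\<And>i j. i \<in> {1..n} \<Longrightarrow> j \<in> {1..n} \<Longrightarrow> G i j = G j i"
    unfolding G_def by (rule G_hat_symmetric[OF dom])
  have "Q_GW g n (G_hat g \<pi>') \<pi>' \<le> Q_GW g n G \<pi>'"
    using dominated_coupling[OF mix_measure_coupling[OF \<pi> V t01]] pos'
    by (intro Q_GW_G_hat_le) (simp_all add: \<pi>')
  also have "\<dots> \<le> Q_GW g n G (mix_measure s \<pi> V)"
    using t s by (auto simp: is_arg_min_linorder \<pi>')
  also have "\<dots> = Q_GW g n G \<pi> + 2 * s * (Q_cross g n G V \<pi> - Q_GW g n G \<pi>)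
      + s\<^sup>2 * (Q_GW g n G \<pi> - 2 * Q_cross g n G V \<pi> + Q_GW g n G V)"
    by (rule Q_GW_mix[OF \<pi> V s G_sym])
  also have "\<dots> \<le> Q_GW g n G \<pi> + 2 * s * (Q_cross g n G \<eta> \<pi> - Q_GW g n G \<pi>) + s\<^sup>2 * (8 * B\<^sup>2)"
  proof -
    have "Q_cross g n G V \<pi> \<le> Q_cross g n G \<eta> \<pi>"
      unfolding G_def by (rule Q_cross_voronoi_le[OF dom V \<eta> n V_comp])
    moreover have "Q_GW g n G \<pi> \<le> 4 * B\<^sup>2" "Q_GW g n G V \<le> 4 * B\<^sup>2" "0 \<le> Q_cross g n G V \<pi>"
      unfolding G_def using Q_GW_G_hat_bound[OF dom pos _ B] \<pi> V Q_cross_nonneg by auto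
    ultimately show ?thesis
      using s by (intro add_mono mult_left_mono) auto
  qed
  finally show ?thesis by (simp add: G_def mult.commute)
qed

text \<open>
  The values decrease and are non-negative, so consecutive values differ by a null sequence. The
  sufficient decrease then bounds the slope \<open>a\<close> towards \<open>\<eta>\<close> from below by \<open>-4B\<^sup>2s\<close> up to a null
  sequence; the slope is continuous along the convergent subsequence, and \<open>s\<close> is arbitrarily
  small. The conclusion is the stationarity condition, in terms of the bilinear form.
\<close>

lemma cluster_point_stationary:
  assumes B: "AE (x, x') in \<xi> \<Otimes>\<^sub>M \<xi>. \<bar>g x x'\<bar> \<le> B" and n: "n \<ge> 1"
    and seq: "cond_gradient_sequence \<xi> g n \<pi>"
    and pos: "\<And>k i. i \<in> {1..n} \<Longrightarrow> measure (component (\<pi> k) i) UNIV > 0"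
    and Q: "Q \<in> prob_measures n" and cluster: "weak_cluster_point \<pi> Q"
    and posQ: "\<And>i. i \<in> {1..n} \<Longrightarrow> measure (component Q i) UNIV > 0"
    and \<eta>: "\<eta> \<in> couplings \<xi> n"
  shows "0 \<le> Q_cross g n (G_hat g Q) \<eta> Q - Q_GW g n (G_hat g Q) Q"
    and "dominated \<xi> n Q"
proof -
  define F where "F k = Q_GW g n (G_hat g (\<pi> k)) (\<pi> k)" for k
  define a where "a k = Q_cross g n (G_hat g (\<pi> k)) \<eta> (\<pi> k) - F k" for k
  define a' where "a' = Q_cross g n (G_hat g Q) \<eta> Q - Q_GW g n (G_hat g Q) Q"
  have step: "cond_gradient_step \<xi> g n (\<pi> k) (\<pi> (Suc k))" for k
    using seq by (simp add: cond_gradient_sequence_def)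
  have coup: "\<pi> k \<in> couplings \<xi> n" for k
  proof (induction k)
    case 0
    show ?case using seq by (simp add: cond_gradient_sequence_def)
  next
    case (Suc k)
    then show ?case
      using step[of k] by (auto simp: cond_gradient_step_def is_arg_min_def intro!: mix_measure_coupling)
  qed
  have decrease: "F (Suc k) \<le> F k + 2 * s * a k + 8 * B\<^sup>2 * s\<^sup>2" if "0 \<le> s" "s \<le> 1" for k s
    unfolding F_def a_def
    by (rule cond_gradient_step_decrease[OF coup step n pos pos B \<eta> that])
  \<comment> \<open>The case \<open>s = 0\<close> of the sufficient decrease is monotonicity.\<close>
  have "decseq F"
    using decrease[of 0] by (intro decseq_SucI) simp
  moreover have "0 \<le> F k" for k
    by (simp add: F_def Q_GW_eq_Q_cross Q_cross_nonneg)
  ultimately obtain l where "F \<longlonglongrightarrow> l"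
    using decseq_convergent[of F 0] by blast
  then have diff: "(\<lambda>k. F (Suc k) - F k) \<longlonglongrightarrow> 0"
    using tendsto_diff[OF LIMSEQ_Suc] by force
  obtain r where r: "strict_mono r" and w: "weakly_converges (\<pi> \<circ> r) Q"
    using cluster by (auto simp: weak_cluster_point_def)
  have coup_r: "(\<pi> \<circ> r) k \<in> couplings \<xi> n" for k by (simp add: coup)
  show dom_Q: "dominated \<xi> n Q"
    unfolding dominated_def using submeasure_weak_limit[OF finite_xi sets_xi coup_r Q w] by blast
  have conv: "L1_converges \<xi> (\<lambda>k. component (\<pi> (r k)) i) (component Q i)" if "i \<in> {1..n}" for i
    using L1_converges_component[OF finite_xi sets_xi coup_r Q w that] by simp
  note dom_r = dominated_coupling[OF coup]
  have const: "L1_converges \<xi> (\<lambda>k. component \<eta> i) (component \<eta> i)" for i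
    by (simp add: L1_converges_def)
  note G_lim = G_hat_tendsto[OF dom_r dom_Q conv posQ]
  have "(\<lambda>k. a (r k)) \<longlonglongrightarrow> a'"
    unfolding a_def a'_def F_def Q_GW_eq_Q_cross
    by (intro tendsto_diff Q_cross_tendsto dom_r dom_Q dominated_coupling[OF \<eta>] conv const G_lim)
  then have lower: "0 \<le> 2 * s * a' + 8 * B\<^sup>2 * s\<^sup>2" if "0 \<le> s" "s \<le> 1" for s
  proof -
    have "(\<lambda>k. F (Suc (r k)) - F (r k)) \<longlonglongrightarrow> 0"
      using LIMSEQ_subseq_LIMSEQ[OF diff r] by (simp add: o_def)
    moreover have "(\<lambda>k. 2 * s * a (r k) + 8 * B\<^sup>2 * s\<^sup>2) \<longlonglongrightarrow> 2 * s * a' + 8 * B\<^sup>2 * s\<^sup>2"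
      by (intro tendsto_intros \<open>(\<lambda>k. a (r k)) \<longlonglongrightarrow> a'\<close>)
    moreover have "F (Suc (r k)) - F (r k) \<le> 2 * s * a (r k) + 8 * B\<^sup>2 * s\<^sup>2" for k
      using decrease[OF that, of "r k"] by linarith
    ultimately show ?thesis
      by (intro LIMSEQ_le) auto
  qed
  have lower': "0 \<le> a' + 4 * B\<^sup>2 * s" if "0 < s" "s \<le> 1" for s
  proof -
    have "0 \<le> 2 * s * (a' + 4 * B\<^sup>2 * s)"
      using lower[of s] that by (simp add: power2_eq_square algebra_simps)
    then show ?thesis using that by (simp add: zero_le_mult_iff)
  qed
  have "(\<lambda>k. a' + 4 * B\<^sup>2 * (1 / real (Suc k))) \<longlonglongrightarrow> a' + 4 * B\<^sup>2 * 0"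
    by (intro tendsto_intros LIMSEQ_Suc[OF lim_1_over_n])
  moreover have "0 \<le> a' + 4 * B\<^sup>2 * (1 / real (Suc k))" for k
    by (rule lower') auto
  ultimately have "0 \<le> a'"
    by (intro LIMSEQ_le_const[of _ a' 0]) auto
  then show "0 \<le> Q_cross g n (G_hat g Q) \<eta> Q - Q_GW g n (G_hat g Q) Q"
    by (simp add: a'_def)
qed

end

theorem theorem5p3:
  fixes \<xi> :: "'a::polish_space measure"
    and g :: "'a \<Rightarrow> 'a \<Rightarrow> real"
    and n :: nat
    and \<pi> :: "nat \<Rightarrow> ('a \<times> nat) measure"
    and \<pi>star :: "('a \<times> nat) measure"
  assumes "gm_space \<xi> g"
    and "bounded_gauge \<xi> g"
    and "n \<ge> 1"
    and "cond_gradient_sequence \<xi> g n \<pi>"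
    and "\<And>k i. i \<in> {1..n} \<Longrightarrow> measure (component (\<pi> k) i) UNIV > 0"
    and "\<pi>star \<in> prob_measures n"
    and "weak_cluster_point \<pi> \<pi>star"
    and "\<And>i. i \<in> {1..n} \<Longrightarrow> measure (component \<pi>star i) UNIV > 0"
  shows "\<forall>\<eta> \<in> couplings \<xi> n.
    2 * (\<Sum>i=1..n. (\<integral>x. c_hat g n \<pi>star i x \<partial>(component \<eta> i))
                 - (\<integral>x. c_hat g n \<pi>star i x \<partial>(component \<pi>star i))) \<ge> 0"
proof
  interpret gm_space \<xi> g by fact
  fix \<eta> assume \<eta>: "\<eta> \<in> couplings \<xi> n"
  obtain B where B: "AE (x, x') in \<xi> \<Otimes>\<^sub>M \<xi>. \<bar>g x x'\<bar> \<le> B"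
    using assms(2) by (auto simp: bounded_gauge_def)
  note stat = cluster_point_stationary[OF B assms(3-8) \<eta>]
  show "2 * (\<Sum>i=1..n. (\<integral>x. c_hat g n \<pi>star i x \<partial>(component \<eta> i))
                 - (\<integral>x. c_hat g n \<pi>star i x \<partial>(component \<pi>star i))) \<ge> 0"
    using stat(1) sum_integral_c_hat[OF stat(2) dominated_coupling[OF \<eta>]] sum_integral_c_hat[OF stat(2) stat(2)]
    by (simp add: sum_subtractf Q_GW_eq_Q_cross)
qed

end
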